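(* Let $p\neq q$ be primes, let $\mathrm{BS}(p,q)=\langle a,t \mid ta^pt^{-1}=a^q\rangle$, and let $G_{p,q}$ be its Schlichting completion (with respect to $\langle a\rangle$), so that $\mathrm{BS}(p,q)\subseteq G_{p,q}$. Let $\alpha\colon G_{p,q}\to G_{p,q}$, $x\mapsto txt^{-1}$, be conjugation by $t$. Then $\alpha$ is expansive but $U_\alpha U_{\alpha^{-1}}$ is not a subgroup of $G_{p,q}$.
   Context: In $\Gamma:=\mathrm{BS}(p,q)$ the subgroup $\Lambda:=\langle a\rangle$ is commensurated, i.e. $\Lambda\cap g\Lambda g^{-1}$ has finite index in $\Lambda$ for each $g\in\Gamma$, and $\bigcap_{g\in \Gamma} g\Lambda g^{-1}=\{1\}$. The Schlichting completion $G_{p,q}$ is the closure of the image of $\Gamma$ in the group $\mathrm{Sym}(\Gamma/\Lambda)$ of all permutations of $\Gamma/\Lambda$ (under the left translation action), where $\mathrm{Sym}(\Gamma/\Lambda)$ carries the topology of pointwise convergence on the discrete set $\Gamma/\Lambda$. It is a totally disconnected, locally compact group containing (an injective image of) $\Gamma$ as a dense subgroup, and the closure of $\langle a\rangle$ in it is a compact open subgroup. An automorphism $\alpha$ of a topological group $G$ (with $\alpha,\alpha^{-1}$ continuous) is expansive if $\bigcap_{n\in\mathbb{Z}}\alpha^n(U)=\{1\}$ for some identity neighbourhood $U\subseteq G$. Contraction groups: $U_\alpha:=\{g\in G\colon \alpha^n(g)\to 1\text{ as }n\to\infty\}$, and $U_{\alpha^{-1}}$ is defined likewise with $\alpha^{-1}$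 in place of $\alpha$. $U_\alpha U_{\alpha^{-1}}=\{xy\colon x\in U_\alpha,\ y\in U_{\alpha^{-1}}\}$. *)

theory Defs
  imports
    "HOL-Analysis.Abstract_Limits"
    "HOL-Analysis.Function_Topology"
    "HOL-Analysis.Product_Topology"
    "HOL-Computational_Algebra.Primes"
    "HOL-Algebra.Bij"
    "HOL-Algebra.Left_Coset"
    "HOL-Algebra.Generated_Groups"
begin

text \<open>
  A word is a list of signed generators: \<open>(x, True)\<close> stands for the generator \<open>x\<close> and
  \<open>(x, False)\<close> for its formal inverse. For a set \<open>R\<close> of pairs \<open>(l, r)\<close>, read as relations
  \<open>l = r\<close>, the group with generators \<open>UNIV :: 'g set\<close> and relations \<open>R\<close> is the quotient of
  the monoid of words by the congruence generated by \<open>R\<close> and by free cancellation.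
\<close>

type_synonym 'g word = "('g \<times> bool) list"

inductive pres_eq :: "('g word \<times> 'g word) set \<Rightarrow> 'g word \<Rightarrow> 'g word \<Rightarrow> bool"
  for R :: "('g word \<times> 'g word) set"
  where
    refl: "pres_eq R w w"
  | sym: "pres_eq R v w \<Longrightarrow> pres_eq R w v"
  | trans: "pres_eq R u v \<Longrightarrow> pres_eq R v w \<Longrightarrow> pres_eq R u w"
  | cancel: "pres_eq R (u @ [(x, b), (x, \<not> b)] @ v) (u @ v)"
  | rel: "(l, r) \<in> R \<Longrightarrow> pres_eq R (u @ l @ v) (u @ r @ v)"

definition pres_class :: "('g word \<times> 'g word) set \<Rightarrow> 'g word \<Rightarrow> 'g word set"
  where "pres_class R w = {v. pres_eq R w v}"

definition presented_group :: "('g word \<times> 'g word) set \<Rightarrow> 'g word set monoid"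
  where "presented_group R =
    \<lparr>carrier = range (pres_class R),
     mult = (\<lambda>X Y. \<Union>u\<in>X. \<Union>v\<in>Y. pres_class R (u @ v)),
     one = pres_class R []\<rparr>"

lemma pres_eq_append_left: "pres_eq R u v \<Longrightarrow> pres_eq R (w @ u) (w @ v)"
proof (induction rule: pres_eq.induct)
  case (cancel u x b v)
  show ?case using pres_eq.cancel[of R "w @ u" x b v] by simp
next
  case (rel l r u v)
  then show ?case using pres_eq.rel[of l r R "w @ u" v] by simp
qed (blast intro: pres_eq.intros)+

lemma pres_eq_append_right: "pres_eq R u v \<Longrightarrow> pres_eq R (u @ w) (v @ w)"
proof (induction rule: pres_eq.induct)
  case (cancel u x b v)
  show ?case using pres_eq.cancel[of R u x b "v @ w"] by simp
next
  case (rel l r u v)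
  then show ?case using pres_eq.rel[of l r R u "v @ w"] by simp
qed (blast intro: pres_eq.intros)+

lemma pres_eq_append: "pres_eq R u u' \<Longrightarrow> pres_eq R v v' \<Longrightarrow> pres_eq R (u @ v) (u' @ v')"
  by (meson pres_eq.trans pres_eq_append_left pres_eq_append_right)

lemma pres_class_eq_iff: "pres_class R u = pres_class R v \<longleftrightarrow> pres_eq R u v"
  unfolding pres_class_def by (blast intro: pres_eq.intros)

lemma presented_group_mult:
  "pres_class R u \<otimes>\<^bsub>presented_group R\<^esub> pres_class R v = pres_class R (u @ v)"
proof -
  have eq: "pres_class R (u' @ v') = pres_class R (u @ v)"
    if "u' \<in> pres_class R u" "v' \<in> pres_class R v" for u' v'
    unfolding pres_class_eq_iff
  proof -
    have "pres_eq R u u'" "pres_eq R v v'" using that by (simp_all add: pres_class_def)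
    then show "pres_eq R (u' @ v') (u @ v)" by (rule pres_eq.sym[OF pres_eq_append])
  qed
  have "u \<in> pres_class R u" "v \<in> pres_class R v"
    by (simp_all add: pres_class_def pres_eq.refl)
  then have "pres_class R u \<noteq> {}" "pres_class R v \<noteq> {}" by auto
  then show ?thesis
    by (simp add: presented_group_def eq cong: SUP_cong)
qed

lemma pres_eq_inverse_word:
  "pres_eq R (rev (map (\<lambda>(x, b). (x, \<not> b)) w) @ w) []"
proof (induction w)
  case (Cons y w)
  obtain x b where y: "y = (x, b)" by (cases y)
  have "pres_eq R (rev (map (\<lambda>(x, b). (x, \<not> b)) w) @ [(x, \<not> b), (x, \<not> \<not> b)] @ w)
      (rev (map (\<lambda>(x, b). (x, \<not> b)) w) @ w)"
    by (rule pres_eq.cancel)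
  then show ?case using Cons y by (auto intro: pres_eq.trans)
qed (simp add: pres_eq.refl)

lemma presented_group_simps:
  "carrier (presented_group R) = range (pres_class R)"
  "\<one>\<^bsub>presented_group R\<^esub> = pres_class R []"
  by (simp_all add: presented_group_def)

lemma group_presented_group: "group (presented_group R)"
proof (rule groupI)
  fix X assume "X \<in> carrier (presented_group R)"
  then obtain w where w: "X = pres_class R w" by (auto simp: presented_group_simps)
  let ?Y = "pres_class R (rev (map (\<lambda>(x, b). (x, \<not> b)) w))"
  have "?Y \<otimes>\<^bsub>presented_group R\<^esub> X = pres_class R []"
    unfolding w presented_group_mult pres_class_eq_iff by (rule pres_eq_inverse_word)
  then show "\<exists>Y\<in>carrier (presented_group R).
      Y \<otimes>\<^bsub>presented_group R\<^esub> X = \<one>\<^bsub>presented_group R\<^esub>"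
    by (auto simp: presented_group_simps)
qed (auto simp: presented_group_simps presented_group_mult)

datatype bs_gen = A | T

text \<open>The single relation is \<open>t a\<^sup>p t\<^sup>-\<^sup>1 = a\<^sup>q\<close>.\<close>

definition bs_rels :: "nat \<Rightarrow> nat \<Rightarrow> (bs_gen word \<times> bs_gen word) set"
  where "bs_rels p q =
    {([(T, True)] @ replicate p (A, True) @ [(T, False)], replicate q (A, True))}"

definition BS :: "nat \<Rightarrow> nat \<Rightarrow> bs_gen word set monoid"
  where "BS p q = presented_group (bs_rels p q)"

definition bs_a :: "nat \<Rightarrow> nat \<Rightarrow> bs_gen word set"
  where "bs_a p q = pres_class (bs_rels p q) [(A, True)]"

definition bs_t :: "nat \<Rightarrow> nat \<Rightarrow> bs_gen word set"
  where "bs_t p q = pres_class (bs_rels p q) [(T, True)]"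

text \<open>
  \<open>Sym(X)\<close> is the library's \<^term>\<open>BijGroup X\<close>, whose elements are extensional functions
  (\<open>undefined\<close> outside \<open>X\<close>); so is the product topology, and pointwise convergence on the
  discrete set \<open>X\<close> is the subspace topology inherited from the product of discrete spaces.
\<close>

definition sym_topology :: "'a set \<Rightarrow> ('a \<Rightarrow> 'a) topology"
  where "sym_topology X =
    subtopology (product_topology (\<lambda>_. discrete_topology X) X) (carrier (BijGroup X))"

definition coset_action :: "('a, 'b) monoid_scheme \<Rightarrow> 'a set \<Rightarrow> 'a \<Rightarrow> 'a set \<Rightarrow> 'a set"
  where "coset_action \<Gamma> \<Lambda> g = (\<lambda>C \<in> lcosets\<^bsub>\<Gamma>\<^esub> \<Lambda>. g <#\<^bsub>\<Gamma>\<^esub> C)"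

definition schlichting :: "('a, 'b) monoid_scheme \<Rightarrow> 'a set \<Rightarrow> ('a set \<Rightarrow> 'a set) monoid"
  where "schlichting \<Gamma> \<Lambda> = BijGroup (lcosets\<^bsub>\<Gamma>\<^esub> \<Lambda>)
    \<lparr>carrier := sym_topology (lcosets\<^bsub>\<Gamma>\<^esub> \<Lambda>) closure_of (coset_action \<Gamma> \<Lambda> ` carrier \<Gamma>)\<rparr>"

definition schlichting_topology ::
    "('a, 'b) monoid_scheme \<Rightarrow> 'a set \<Rightarrow> ('a set \<Rightarrow> 'a set) topology"
  where "schlichting_topology \<Gamma> \<Lambda> =
    subtopology (sym_topology (lcosets\<^bsub>\<Gamma>\<^esub> \<Lambda>)) (carrier (schlichting \<Gamma> \<Lambda>))"

definition topological_group :: "('a, 'b) monoid_scheme \<Rightarrow> 'a topology \<Rightarrow> bool"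
  where "topological_group G \<tau> \<longleftrightarrow>
    group G \<and> topspace \<tau> = carrier G \<and>
    continuous_map (prod_topology \<tau> \<tau>) \<tau> (\<lambda>(x, y). x \<otimes>\<^bsub>G\<^esub> y) \<and>
    continuous_map \<tau> \<tau> (\<lambda>x. inv\<^bsub>G\<^esub> x)"

definition topological_automorphism ::
    "('a, 'b) monoid_scheme \<Rightarrow> 'a topology \<Rightarrow> ('a \<Rightarrow> 'a) \<Rightarrow> bool"
  where "topological_automorphism G \<tau> \<alpha> \<longleftrightarrow>
    topological_group G \<tau> \<and> \<alpha> \<in> carrier (AutoGroup G) \<and>
    continuous_map \<tau> \<tau> \<alpha> \<and> continuous_map \<tau> \<tau> (inv\<^bsub>AutoGroup G\<^esub> \<alpha>)"

definition expansive :: "('a, 'b) monoid_scheme \<Rightarrow> 'a topology \<Rightarrow> ('a \<Rightarrow> 'a) \<Rightarrow> bool"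
  where "expansive G \<tau> \<alpha> \<longleftrightarrow>
    topological_automorphism G \<tau> \<alpha> \<and>
    (\<exists>U \<subseteq> carrier G. (\<exists>V. openin \<tau> V \<and> \<one>\<^bsub>G\<^esub> \<in> V \<and> V \<subseteq> U) \<and>
       (\<Inter>n::int. (\<alpha> [^]\<^bsub>AutoGroup G\<^esub> n) ` U) = {\<one>\<^bsub>G\<^esub>})"

definition contraction_group ::
    "('a, 'b) monoid_scheme \<Rightarrow> 'a topology \<Rightarrow> ('a \<Rightarrow> 'a) \<Rightarrow> 'a set"
  where "contraction_group G \<tau> \<alpha> =
    {g \<in> carrier G. limitin \<tau> (\<lambda>n::nat. (\<alpha> [^]\<^bsub>AutoGroup G\<^esub> n) g) \<one>\<^bsub>G\<^esub> sequentially}"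

definition conjugation :: "('a, 'b) monoid_scheme \<Rightarrow> 'a \<Rightarrow> 'a \<Rightarrow> 'a"
  where "conjugation G t = (\<lambda>x \<in> carrier G. t \<otimes>\<^bsub>G\<^esub> x \<otimes>\<^bsub>G\<^esub> inv\<^bsub>G\<^esub> t)"

end

theory Submission
  imports Defs
begin

text \<open>
  Let \<open>K\<close> be the closure of \<open>\<Lambda> = \<langle>a\<rangle>\<close>, the stabilizer of the coset \<open>\<Lambda>\<close>. The translate \<open>\<alpha>\<^sup>n(K)\<close> is
  the stabilizer of \<open>t\<^sup>n \<Lambda>\<close>. A power \<open>a\<^sup>k\<close> fixing \<open>t\<^sup>n \<Lambda>\<close> and \<open>t\<^sup>-\<^sup>n \<Lambda>\<close> has \<open>k\<close> divisible by
  \<open>(p q)\<^sup>n\<close>, and powers of \<open>a\<close> with such exponents fix any given coset once \<open>n\<close> is large; so \<open>\<alpha>\<close> is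
  expansive.

  Splitting \<open>K \<cong> \<int>\<^sub>p \<times> \<int>\<^sub>q\<close> writes \<open>a\<close> as a product of elements contracted by \<open>\<alpha>\<close> and by
  \<open>\<alpha>\<^sup>-\<^sup>1\<close>. If the product set were a subgroup, it would contain the commutator \<open>g\<close> of
  \<open>t a t\<^sup>-\<^sup>1\<close> and \<open>a\<close>. Comparing the actions on \<open>t\<^sup>n \<Lambda>\<close> and \<open>t\<^sup>-\<^sup>n \<Lambda>\<close> for large \<open>n\<close> would give
  \<open>t\<^sup>n g t\<^sup>n = a\<^sup>i t\<^sup>2\<^sup>n a\<^sup>j\<close>. Under the affine action \<open>a x = x + 1\<close>, \<open>t x = (q / p) x\<close> on the
  rationals \<open>g\<close> is trivial, which forces \<open>i p\<^sup>2\<^sup>n + j q\<^sup>2\<^sup>n = 0\<close> and hence \<open>g = 1\<close>. Another action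
  on the rationals shows that \<open>g \<noteq> 1\<close>.
\<close>

section \<open>Symmetric groups with pointwise convergence\<close>

text \<open>A basic open set of the product constrains only finitely many coordinates, and these
  form the set \<open>F\<close>.\<close>

lemma openin_sym_topology:
  "openin (sym_topology X) W \<longleftrightarrow> W \<subseteq> Bij X \<and>
    (\<forall>f\<in>W. \<exists>F. finite F \<and> F \<subseteq> X \<and> (\<forall>g\<in>Bij X. (\<forall>x\<in>F. g x = f x) \<longrightarrow> g \<in> W))"
    (is "?L \<longleftrightarrow> ?R")
proof
  assume ?L
  then obtain S where S: "openin (product_topology (\<lambda>_. discrete_topology X) X) S"
    and W: "W = S \<inter> Bij X"
    by (auto simp: sym_topology_def openin_subtopology BijGroup_def)
  have "\<exists>F. finite F \<and> F \<subseteq> X \<and> (\<forall>g\<in>Bij X. (\<forall>x\<in>F. g x = f x) \<longrightarrow> g \<in> W)" if "f \<in> W" for f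
  proof -
    from S that W obtain U where U: "finite {i \<in> X. U i \<noteq> X}" "f \<in> Pi\<^sub>E X U" "Pi\<^sub>E X U \<subseteq> S"
      unfolding openin_product_topology_alt topspace_discrete_topology
      by blast
    show ?thesis
    proof (intro exI conjI ballI impI)
      show "finite {i \<in> X. U i \<noteq> X}" by fact
      fix g assume g: "g \<in> Bij X" "\<forall>x\<in>{i \<in> X. U i \<noteq> X}. g x = f x"
      have "g x \<in> U x" if "x \<in> X" for x
        using g that U(2) by (cases "U x = X") (auto dest: Bij_imp_funcset)
      then have "g \<in> Pi\<^sub>E X U" using g by (auto simp: PiE_iff Bij_imp_extensional)
      then show "g \<in> W" using U g W by auto
    qed auto
  qed
  then show ?R using W by auto
next
  assume R: ?R
  \<comment> \<open>\<open>W\<close> is seldom open in the product itself. \<open>S\<close> thickens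
    it to all self-maps of \<open>X\<close>, bijective or not, that agree with some
    \<open>f \<in> W\<close> on a set \<open>F\<close> witnessing openness at
    \<open>f\<close>.\<close>
  define S where "S = {h \<in> X \<rightarrow>\<^sub>E X. \<exists>f\<in>W. \<exists>F. finite F \<and> F \<subseteq> X \<and>
      (\<forall>g\<in>Bij X. (\<forall>x\<in>F. g x = f x) \<longrightarrow> g \<in> W) \<and> (\<forall>x\<in>F. h x = f x)}"
  have "openin (product_topology (\<lambda>_. discrete_topology X) X) S"
    unfolding openin_product_topology_alt
  proof
    fix h assume "h \<in> S"
    then obtain f F where h: "h \<in> X \<rightarrow>\<^sub>E X" and f: "f \<in> W" and F: "finite F" "F \<subseteq> X"
      "\<forall>g\<in>Bij X. (\<forall>x\<in>F. g x = f x) \<longrightarrow> g \<in> W" "\<forall>x\<in>F. h x = f x"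
      unfolding S_def by blast
    define U where "U i = (if i \<in> F then {h i} else X)" for i
    show "\<exists>U. finite {i \<in> X. U i \<noteq> topspace (discrete_topology X)} \<and>
        (\<forall>i\<in>X. openin (discrete_topology X) (U i)) \<and> h \<in> Pi\<^sub>E X U \<and> Pi\<^sub>E X U \<subseteq> S"
    proof (intro exI[of _ U] conjI)
      show "finite {i \<in> X. U i \<noteq> topspace (discrete_topology X)}"
        by (rule finite_subset[OF _ F(1)]) (auto simp: U_def)
      show "\<forall>i\<in>X. openin (discrete_topology X) (U i)" "h \<in> Pi\<^sub>E X U"
        using h by (auto simp: U_def PiE_iff)
      show "Pi\<^sub>E X U \<subseteq> S"
      proof
        fix k assume k: "k \<in> Pi\<^sub>E X U"
        have "k x = h x" if "x \<in> F" for x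
          using that F k by (auto simp: U_def PiE_iff split: if_splits dest!: bspec[of _ _ x])
        moreover have "k \<in> X \<rightarrow>\<^sub>E X"
          using k h by (auto simp: U_def PiE_iff split: if_splits)
        ultimately show "k \<in> S" using f F unfolding S_def by auto
      qed
    qed
  qed
  moreover have "W = S \<inter> Bij X"
  proof
    show "W \<subseteq> S \<inter> Bij X"
    proof
      fix f assume "f \<in> W"
      then have "f \<in> Bij X" using R by auto
      then have "f \<in> X \<rightarrow>\<^sub>E X" by (auto simp: PiE_iff Bij_imp_extensional dest: Bij_imp_funcset)
      then show "f \<in> S \<inter> Bij X" using R \<open>f \<in> W\<close> \<open>f \<in> Bij X\<close> unfolding S_def by blast
    qed
  qed (auto simp: S_def)
  ultimately show ?L by (auto simp: sym_topology_def openin_subtopology BijGroup_def)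
qed

lemma topspace_sym_topology: "topspace (sym_topology X) = Bij X"
proof
  show "topspace (sym_topology X) \<subseteq> Bij X"
    by (auto simp: sym_topology_def BijGroup_def)
  have "openin (sym_topology X) (Bij X)"
    unfolding openin_sym_topology by auto
  then show "Bij X \<subseteq> topspace (sym_topology X)" by (rule openin_subset)
qed

text \<open>Prescribing the values on a finite set gives a neighbourhood base, so closure points are
  those matched by \<open>S\<close> on every finite set.\<close>

lemma in_closure_of_sym_topology:
  assumes "S \<subseteq> Bij X"
  shows "f \<in> sym_topology X closure_of S \<longleftrightarrow>
    f \<in> Bij X \<and> (\<forall>F. finite F \<and> F \<subseteq> X \<longrightarrow> (\<exists>g\<in>S. \<forall>x\<in>F. g x = f x))"
proof -
  have *: "openin (sym_topology X) {g \<in> Bij X. \<forall>x\<in>F. g x = f x}" if "finite F" "F \<subseteq> X" for F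
    unfolding openin_sym_topology using that by (intro conjI ballI exI[of _ F]) auto
  show ?thesis (is "?L \<longleftrightarrow> ?R")
  proof
    assume L: ?L
    then have cl: "\<And>T. f \<in> T \<Longrightarrow> openin (sym_topology X) T \<Longrightarrow> \<exists>y. y \<in> S \<and> y \<in> T"
      and f: "f \<in> Bij X"
      by (auto simp: in_closure_of topspace_sym_topology)
    have "\<exists>g\<in>S. \<forall>x\<in>F. g x = f x" if "finite F" "F \<subseteq> X" for F
      using cl[OF _ *[OF that]] f by blast
    with f show ?R by blast
  next
    assume R: ?R
    have "\<exists>y. y \<in> S \<and> y \<in> T" if T: "f \<in> T" "openin (sym_topology X) T" for T
    proof -
      from T obtain F where "finite F" "F \<subseteq> X" "\<forall>g\<in>Bij X. (\<forall>x\<in>F. g x = f x) \<longrightarrow> g \<in> T"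
        unfolding openin_sym_topology by meson
      moreover obtain g where "g \<in> S" "\<forall>x\<in>F. g x = f x"
        using R \<open>finite F\<close> \<open>F \<subseteq> X\<close> by meson
      ultimately show ?thesis using assms by auto
    qed
    with R show ?L by (auto simp: in_closure_of topspace_sym_topology)
  qed
qed

section \<open>Subgroups of a symmetric group as topological groups\<close>

locale permutation_group =
  fixes X :: "'a set" and P :: "('a \<Rightarrow> 'a) set"
  assumes subgroup_P: "subgroup P (BijGroup X)"
begin

definition G :: "('a \<Rightarrow> 'a) monoid" where "G = BijGroup X \<lparr>carrier := P\<rparr>"

definition \<tau> :: "('a \<Rightarrow> 'a) topology" where "\<tau> = subtopology (sym_topology X) P"

lemma carrier_G: "carrier G = P"
  by (simp add: G_def)

lemma P_subset: "P \<subseteq> Bij X"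
  using subgroup.subset[OF subgroup_P] by (simp add: BijGroup_def)

lemma in_Bij: "f \<in> carrier G \<Longrightarrow> f \<in> Bij X"
  using P_subset carrier_G by auto

lemma group_G: "group G"
  unfolding G_def by (rule group.subgroup_imp_group[OF group_BijGroup subgroup_P])

sublocale G: group G
  by (rule group_G)

lemma image_in: "f \<in> carrier G \<Longrightarrow> x \<in> X \<Longrightarrow> f x \<in> X"
  by (rule funcset_mem[OF Bij_imp_funcset[OF in_Bij]])

lemma mult_apply:
  "f \<in> carrier G \<Longrightarrow> g \<in> carrier G \<Longrightarrow> x \<in> X \<Longrightarrow> (f \<otimes>\<^bsub>G\<^esub> g) x = f (g x)"
  using in_Bij[of f] in_Bij[of g] by (simp add: G_def BijGroup_def compose_eq)

lemma one_apply: "x \<in> X \<Longrightarrow> \<one>\<^bsub>G\<^esub> x = x"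
  by (simp add: G_def BijGroup_def)

lemma inv_apply_eq:
  assumes "f \<in> carrier G" "x \<in> X"
  shows "(inv\<^bsub>G\<^esub> f) (f x) = x" "f ((inv\<^bsub>G\<^esub> f) x) = x"
  using assms mult_apply[of "inv\<^bsub>G\<^esub> f" f x] mult_apply[of f "inv\<^bsub>G\<^esub> f" x] by (simp_all add: one_apply)

lemma ext:
  assumes "f \<in> carrier G" "g \<in> carrier G" "\<And>x. x \<in> X \<Longrightarrow> f x = g x"
  shows "f = g"
  using assms by (intro extensionalityI[of f X g] Bij_imp_extensional in_Bij)

lemma openin_\<tau>:
  "openin \<tau> W \<longleftrightarrow> W \<subseteq> carrier G \<and>
    (\<forall>f\<in>W. \<exists>F. finite F \<and> F \<subseteq> X \<and> (\<forall>g\<in>carrier G. (\<forall>x\<in>F. g x = f x) \<longrightarrow> g \<in> W))"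
    (is "?L \<longleftrightarrow> ?R")
proof
  assume ?L
  then obtain S where S: "openin (sym_topology X) S" and W: "W = S \<inter> P"
    by (auto simp: \<tau>_def openin_subtopology)
  show ?R
    unfolding carrier_G
  proof (intro conjI ballI)
    fix f assume "f \<in> W"
    then have "f \<in> S" using W by simp
    then obtain F where "finite F" "F \<subseteq> X" "\<forall>g\<in>Bij X. (\<forall>x\<in>F. g x = f x) \<longrightarrow> g \<in> S"
      using S unfolding openin_sym_topology by meson
    then show "\<exists>F. finite F \<and> F \<subseteq> X \<and> (\<forall>g\<in>P. (\<forall>x\<in>F. g x = f x) \<longrightarrow> g \<in> W)"
      using W P_subset by (intro exI[of _ F]) auto
  qed (use W in auto)
next
  assume R: ?R
  define S where "S = {h \<in> Bij X. \<exists>f\<in>W. \<exists>F. finite F \<and> F \<subseteq> X \<and>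
    (\<forall>g\<in>carrier G. (\<forall>x\<in>F. g x = f x) \<longrightarrow> g \<in> W) \<and> (\<forall>x\<in>F. h x = f x)}"
  have "openin (sym_topology X) S"
    unfolding openin_sym_topology
  proof (intro conjI ballI)
    fix h assume "h \<in> S"
    then obtain f F where "f \<in> W" "finite F" "F \<subseteq> X"
      "\<forall>g\<in>carrier G. (\<forall>x\<in>F. g x = f x) \<longrightarrow> g \<in> W" "\<forall>x\<in>F. h x = f x"
      unfolding S_def by blast
    then show "\<exists>F. finite F \<and> F \<subseteq> X \<and> (\<forall>g\<in>Bij X. (\<forall>x\<in>F. g x = h x) \<longrightarrow> g \<in> S)"
      unfolding S_def by (intro exI[of _ F]) auto
  qed (auto simp: S_def)
  moreover have "W = S \<inter> P"
  proof
    show "W \<subseteq> S \<inter> P"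
    proof
      fix f assume "f \<in> W"
      then show "f \<in> S \<inter> P" using R P_subset unfolding S_def carrier_G by blast
    qed
  qed (auto simp: S_def carrier_G)
  ultimately show ?L by (auto simp: \<tau>_def openin_subtopology)
qed

lemma openin_agree:
  "finite F \<Longrightarrow> F \<subseteq> X \<Longrightarrow> openin \<tau> {g \<in> carrier G. \<forall>x\<in>F. g x = f x}"
  unfolding openin_\<tau> by (intro conjI ballI exI[of _ F]) auto

lemma topspace_\<tau>: "topspace \<tau> = carrier G"
  using P_subset by (auto simp: \<tau>_def topspace_sym_topology carrier_G)

text \<open>A neighbourhood of \<open>l\<close> constrains finitely many points, and finitely many
  eventual equalities eventually hold together.\<close>

lemma limitin_\<tau>:
  assumes "\<And>n. f n \<in> carrier G"
  shows "limitin \<tau> f l F \<longleftrightarrow> l \<in> carrier G \<and> (\<forall>x\<in>X. \<forall>\<^sub>F n in F. f n x = l x)"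
proof (intro iffI conjI ballI)
  fix x assume l: "limitin \<tau> f l F" and "x \<in> X"
  then have "\<forall>\<^sub>F n in F. f n \<in> {g \<in> carrier G. \<forall>y\<in>{x}. g y = l y}"
    using openin_agree[of "{x}" l] unfolding limitin_def topspace_\<tau> by auto
  then show "\<forall>\<^sub>F n in F. f n x = l x" by eventually_elim auto
next
  assume l: "l \<in> carrier G \<and> (\<forall>x\<in>X. \<forall>\<^sub>F n in F. f n x = l x)"
  show "limitin \<tau> f l F"
    unfolding limitin_def topspace_\<tau>
  proof (intro conjI allI impI; (elim conjE)?)
    fix U assume "openin \<tau> U" "l \<in> U"
    then obtain F' where F': "finite F'" "F' \<subseteq> X" "\<forall>g\<in>carrier G. (\<forall>x\<in>F'. g x = l x) \<longrightarrow> g \<in> U"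
      unfolding openin_\<tau> by blast
    then have "\<forall>\<^sub>F n in F. \<forall>x\<in>F'. f n x = l x"
      using l by (subst eventually_ball_finite_distrib) auto
    then show "\<forall>\<^sub>F n in F. f n \<in> U"
      by eventually_elim (use F' assms in auto)
  qed (use l in auto)
qed (auto simp: limitin_def topspace_\<tau>)

text \<open>To keep a product fixed on \<open>F\<close>, it is enough to keep \<open>g\<close> fixed
  on \<open>F\<close> and \<open>f\<close> fixed on the image of \<open>F\<close> under
  \<open>g\<close>.\<close>

lemma continuous_mult:
  "continuous_map (prod_topology \<tau> \<tau>) \<tau> (\<lambda>(f, g). f \<otimes>\<^bsub>G\<^esub> g)"
  unfolding continuous_map
proof (intro conjI allI impI)
  fix W assume W: "openin \<tau> W"
  let ?V = "{z \<in> topspace (prod_topology \<tau> \<tau>). (case z of (f, g) \<Rightarrow> f \<otimes>\<^bsub>G\<^esub> g) \<in> W}"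
  show "openin (prod_topology \<tau> \<tau>) ?V"
    unfolding openin_prod_topology_alt
  proof (intro allI impI)
    fix f g assume fg: "(f, g) \<in> ?V"
    then have f: "f \<in> carrier G" and g: "g \<in> carrier G" and "f \<otimes>\<^bsub>G\<^esub> g \<in> W"
      by (simp_all add: topspace_\<tau>)
    then obtain F where F: "finite F" "F \<subseteq> X"
      "\<forall>h\<in>carrier G. (\<forall>x\<in>F. h x = (f \<otimes>\<^bsub>G\<^esub> g) x) \<longrightarrow> h \<in> W"
      using W unfolding openin_\<tau> by meson
    have gF: "g ` F \<subseteq> X" "finite (g ` F)" using F g image_in[OF g] by auto
    let ?A = "{h \<in> carrier G. \<forall>x\<in>g ` F. h x = f x}"
    let ?B = "{h \<in> carrier G. \<forall>x\<in>F. h x = g x}"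
    show "\<exists>U V. openin \<tau> U \<and> openin \<tau> V \<and> f \<in> U \<and> g \<in> V \<and> U \<times> V \<subseteq> ?V"
    proof (rule exI[of _ ?A], rule exI[of _ ?B], intro conjI)
      show "openin \<tau> ?A" by (rule openin_agree[OF gF(2,1)])
      show "openin \<tau> ?B" by (rule openin_agree[OF F(1,2)])
      show "?A \<times> ?B \<subseteq> ?V"
      proof (rule subrelI)
        fix f' g' assume "(f', g') \<in> ?A \<times> ?B"
        then have f': "f' \<in> carrier G" "\<forall>x\<in>g ` F. f' x = f x"
          and g': "g' \<in> carrier G" "\<forall>x\<in>F. g' x = g x" by simp_all
        have "(f' \<otimes>\<^bsub>G\<^esub> g') x = (f \<otimes>\<^bsub>G\<^esub> g) x" if "x \<in> F" for x
          using that f g f' g' F(2) by (simp add: mult_apply subset_iff)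
        then have "f' \<otimes>\<^bsub>G\<^esub> g' \<in> W"
          using F(3) f' g' by simp
        then show "(f', g') \<in> ?V"
          using f' g' by (simp add: topspace_\<tau>)
      qed
    qed (use f g in auto)
  qed
qed (auto simp: topspace_\<tau>)

lemma continuous_inv: "continuous_map \<tau> \<tau> (\<lambda>f. inv\<^bsub>G\<^esub> f)"
  unfolding continuous_map
proof (intro conjI allI impI)
  fix W assume W: "openin \<tau> W"
  let ?V = "{f \<in> topspace \<tau>. inv\<^bsub>G\<^esub> f \<in> W}"
  show "openin \<tau> ?V"
    unfolding openin_\<tau>
  proof (intro conjI ballI)
    fix f assume "f \<in> ?V"
    then have f: "f \<in> carrier G" and "inv\<^bsub>G\<^esub> f \<in> W" by (simp_all add: topspace_\<tau>)
    then obtain F where F: "finite F" "F \<subseteq> X"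
      "\<forall>h\<in>carrier G. (\<forall>x\<in>F. h x = (inv\<^bsub>G\<^esub> f) x) \<longrightarrow> h \<in> W"
      using W unfolding openin_\<tau> by meson
    let ?F = "(inv\<^bsub>G\<^esub> f) ` F"
    show "\<exists>F. finite F \<and> F \<subseteq> X \<and> (\<forall>g\<in>carrier G. (\<forall>x\<in>F. g x = f x) \<longrightarrow> g \<in> ?V)"
    proof (intro exI[of _ ?F] conjI ballI impI)
      show "?F \<subseteq> X" using F image_in[OF G.inv_closed[OF f]] by auto
      fix g assume g: "g \<in> carrier G" "\<forall>x\<in>?F. g x = f x"
      have "(inv\<^bsub>G\<^esub> g) x = (inv\<^bsub>G\<^esub> f) x" if "x \<in> F" for x
      proof -
        have x: "x \<in> X" using that F by auto
        have "g ((inv\<^bsub>G\<^esub> f) x) = x" using g that f x by (simp add: inv_apply_eq(2))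
        then show ?thesis
          using inv_apply_eq(1)[OF g(1), of "(inv\<^bsub>G\<^esub> f) x"] f x by (simp add: image_in)
      qed
      then show "g \<in> ?V" using F g by (simp add: topspace_\<tau>)
    qed (use F in auto)
  qed (auto simp: topspace_\<tau>)
qed (auto simp: topspace_\<tau>)

lemma topological_group_G: "topological_group G \<tau>"
  unfolding topological_group_def
  using group_G topspace_\<tau> continuous_mult continuous_inv by auto

end

section \<open>Conjugation\<close>

lemma (in group) conjugation_apply:
  "x \<in> carrier G \<Longrightarrow> conjugation G g x = g \<otimes> x \<otimes> inv g"
  by (simp add: conjugation_def)

lemma (in group) conjugation_closed:
  "g \<in> carrier G \<Longrightarrow> x \<in> carrier G \<Longrightarrow> conjugation G g x \<in> carrier G"
  by (simp add: conjugation_def)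

lemma (in group) conjugation_compose:
  assumes "g \<in> carrier G" "h \<in> carrier G"
  shows "conjugation G (g \<otimes> h) = compose (carrier G) (conjugation G g) (conjugation G h)"
  using assms by (auto simp: conjugation_def compose_def inv_mult_group m_assoc fun_eq_iff)

lemma (in group) conjugation_one: "conjugation G \<one> = (\<lambda>x\<in>carrier G. x)"
  by (auto simp: conjugation_def)

lemma (in group) conjugation_in_auto:
  assumes "g \<in> carrier G"
  shows "conjugation G g \<in> auto G"
proof -
  have "conjugation G g \<in> hom G G"
    using assms by (auto simp: hom_def conjugation_def m_assoc inv_solve_left)
  moreover have "bij_betw (conjugation G g) (carrier G) (carrier G)"
  proof (rule bij_betw_byWitness[where f' = "conjugation G (inv g)"])
    show "\<forall>a\<in>carrier G. conjugation G (inv g) (conjugation G g a) = a"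
      "\<forall>a\<in>carrier G. conjugation G g (conjugation G (inv g) a) = a"
      using conjugation_compose[of "inv g" g] conjugation_compose[of g "inv g"] assms
      by (auto simp: conjugation_one compose_def fun_eq_iff restrict_def split: if_splits)
  qed (use assms conjugation_closed in auto)
  ultimately show ?thesis
    by (auto simp: auto_def Bij_def conjugation_def)
qed

text \<open>This reduces the powers and inverses in \<open>AutoGroup G\<close>, which occur in the
  definitions of expansiveness and of contraction groups, to powers and inverses of the conjugating
  element.\<close>

lemma (in group) conjugation_hom: "conjugation G \<in> hom G (AutoGroup G)"
proof (rule homI)
  fix g h assume "g \<in> carrier G" "h \<in> carrier G"
  then show "conjugation G (g \<otimes> h) = conjugation G g \<otimes>\<^bsub>AutoGroup G\<^esub> conjugation G h"
    using conjugation_in_auto[of g] conjugation_in_auto[of h]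
    by (simp add: conjugation_compose AutoGroup_def BijGroup_def auto_def)
qed (simp add: AutoGroup_def conjugation_in_auto)

lemma (in group) conjugation_int_pow:
  "g \<in> carrier G \<Longrightarrow> conjugation G g [^]\<^bsub>AutoGroup G\<^esub> (n::int) = conjugation G (g [^] n)"
  using hom_int_pow[OF conjugation_hom] is_group AutoGroup by metis

lemma (in group) inv_conjugation:
  "g \<in> carrier G \<Longrightarrow> inv\<^bsub>AutoGroup G\<^esub> (conjugation G g) = conjugation G (inv g)"
  using group_hom.hom_inv[of G "AutoGroup G" "conjugation G" g] conjugation_hom is_group AutoGroup
  by (simp add: group_hom_def group_hom_axioms_def)

lemma (in group) conjugation_nat_pow:
  "g \<in> carrier G \<Longrightarrow> conjugation G g [^]\<^bsub>AutoGroup G\<^esub> (n::nat) = conjugation G (g [^] n)"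
  using conjugation_int_pow[of g "int n"] by (simp add: int_pow_int)

lemma topological_automorphism_conjugation:
  assumes tg: "topological_group G \<tau>" and g: "g \<in> carrier G"
  shows "topological_automorphism G \<tau> (conjugation G g)"
proof -
  interpret group G using tg by (simp add: topological_group_def)
  have top: "topspace \<tau> = carrier G"
    and mult: "continuous_map (prod_topology \<tau> \<tau>) \<tau> (\<lambda>(x, y). x \<otimes>\<^bsub>G\<^esub> y)"
    using tg by (auto simp: topological_group_def)
  have mult': "continuous_map \<tau> \<tau> (\<lambda>x. u x \<otimes>\<^bsub>G\<^esub> v x)"
    if "continuous_map \<tau> \<tau> u" "continuous_map \<tau> \<tau> v" for u v
    using continuous_map_compose[OF continuous_map_pairedI[OF that] mult] by (simp add: o_def)
  have cont: "continuous_map \<tau> \<tau> (conjugation G h)" if "h \<in> carrier G" for h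
  proof (rule continuous_map_eq)
    show "continuous_map \<tau> \<tau> (\<lambda>x. h \<otimes>\<^bsub>G\<^esub> x \<otimes>\<^bsub>G\<^esub> inv\<^bsub>G\<^esub> h)"
      using that by (intro mult' continuous_map_const[THEN iffD2] continuous_map_id[unfolded id_def])
        (auto simp: top)
  qed (use that top in \<open>auto simp: conjugation_apply\<close>)
  have "conjugation G g \<in> carrier (AutoGroup G)"
    using conjugation_in_auto[OF g] by (simp add: AutoGroup_def)
  then show ?thesis
    unfolding topological_automorphism_def using tg g cont by (simp add: inv_conjugation)
qed

section \<open>The Schlichting completion\<close>

text \<open>Approximants of \<open>f\<close> on the image of \<open>F\<close> under \<open>g\<close>
  and of \<open>g\<close> on \<open>F\<close> multiply to an approximant of the product on
  \<open>F\<close>. For inverses, \<open>f\<close> is approximated on the preimage of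
  \<open>F\<close>.\<close>

lemma subgroup_closure_of_sym_topology:
  assumes S: "subgroup S (BijGroup X)"
  shows "subgroup (sym_topology X closure_of S) (BijGroup X)"
proof -
  have carr: "carrier (BijGroup X) = Bij X"
    by (simp add: BijGroup_def)
  \<comment> \<open>The whole symmetric group is an instance of the locale, which supplies the
    evaluation rules for products and inverses.\<close>
  interpret B: permutation_group X "Bij X"
    using group.subgroup_self[OF group_BijGroup, of X] by (intro permutation_group.intro) (simp only: carr)
  have G: "B.G = BijGroup X"
    by (simp add: B.G_def BijGroup_def)
  have sub: "S \<subseteq> Bij X"
    using subgroup.subset[OF S] by (simp add: carr)
  note cl = in_closure_of_sym_topology[OF sub]
  note mult = B.mult_apply[unfolded G carr]
  note inv = B.inv_apply_eq[unfolded G carr]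
  have inv_Bij: "inv\<^bsub>BijGroup X\<^esub> f \<in> Bij X" if "f \<in> Bij X" for f
    using group.inv_closed[OF group_BijGroup, of f X] that by (simp add: carr)
  have in_X: "f x \<in> X" if "f \<in> Bij X" "x \<in> X" for f x
    by (rule funcset_mem[OF Bij_imp_funcset[OF that(1)] that(2)])
  show ?thesis
  proof (rule group.subgroupI[OF group_BijGroup])
    show "sym_topology X closure_of S \<subseteq> carrier (BijGroup X)"
      by (auto simp: cl carr)
    have "\<one>\<^bsub>BijGroup X\<^esub> \<in> sym_topology X closure_of S"
      unfolding cl using subgroup.one_closed[OF S] sub by auto
    then show "sym_topology X closure_of S \<noteq> {}" by auto
  next
    fix f assume "f \<in> sym_topology X closure_of S"
    then have f: "f \<in> Bij X"
      and approx: "\<And>F. finite F \<Longrightarrow> F \<subseteq> X \<Longrightarrow> \<exists>g\<in>S. \<forall>x\<in>F. g x = f x"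
      by (auto simp: cl)
    have "\<exists>g\<in>S. \<forall>x\<in>F. g x = (inv\<^bsub>BijGroup X\<^esub> f) x" if F: "finite F" "F \<subseteq> X" for F
    proof -
      let ?F = "(inv\<^bsub>BijGroup X\<^esub> f) ` F"
      have F': "finite ?F" "?F \<subseteq> X" using F in_X[OF inv_Bij[OF f]] by auto
      obtain g where g: "g \<in> S" "\<forall>x\<in>?F. g x = f x" using approx[OF F'] by auto
      then have gB: "g \<in> Bij X" using sub by auto
      have "(inv\<^bsub>BijGroup X\<^esub> g) x = (inv\<^bsub>BijGroup X\<^esub> f) x" if "x \<in> F" for x
      proof -
        have x: "x \<in> X" using that F by auto
        have "g ((inv\<^bsub>BijGroup X\<^esub> f) x) = x" using g that f x by (simp add: inv(2))
        then show ?thesis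
          using inv(1)[OF gB, of "(inv\<^bsub>BijGroup X\<^esub> f) x"] in_X[OF inv_Bij[OF f] x] by simp
      qed
      then show ?thesis using g subgroup.m_inv_closed[OF S] by blast
    qed
    then show "inv\<^bsub>BijGroup X\<^esub> f \<in> sym_topology X closure_of S"
      unfolding cl using inv_Bij[OF f] by blast
  next
    fix f g assume "f \<in> sym_topology X closure_of S" "g \<in> sym_topology X closure_of S"
    then have f: "f \<in> Bij X" and g: "g \<in> Bij X"
      and approx: "\<And>F. finite F \<Longrightarrow> F \<subseteq> X \<Longrightarrow> \<exists>h\<in>S. \<forall>x\<in>F. h x = f x"
        "\<And>F. finite F \<Longrightarrow> F \<subseteq> X \<Longrightarrow> \<exists>h\<in>S. \<forall>x\<in>F. h x = g x"
      by (auto simp: cl)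
    have "\<exists>h\<in>S. \<forall>x\<in>F. h x = (f \<otimes>\<^bsub>BijGroup X\<^esub> g) x" if F: "finite F" "F \<subseteq> X" for F
    proof -
      have F': "finite (g ` F)" "g ` F \<subseteq> X" using F in_X[OF g] by auto
      obtain f' where f': "f' \<in> S" "\<forall>x\<in>g ` F. f' x = f x" using approx(1)[OF F'] by auto
      obtain g' where g': "g' \<in> S" "\<forall>x\<in>F. g' x = g x" using approx(2)[OF F] by auto
      have B: "f' \<in> Bij X" "g' \<in> Bij X" using f' g' sub by auto
      have "(f' \<otimes>\<^bsub>BijGroup X\<^esub> g') x = (f \<otimes>\<^bsub>BijGroup X\<^esub> g) x" if "x \<in> F" for x
        using that f' g' F f g B by (simp add: mult subset_iff)
      then show ?thesis using subgroup.m_closed[OF S] f' g' by blast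
    qed
    then show "f \<otimes>\<^bsub>BijGroup X\<^esub> g \<in> sym_topology X closure_of S"
      unfolding cl using group.is_monoid[OF group_BijGroup, of X] f g monoid.m_closed[of "BijGroup X" f g]
      by (auto simp: carr)
  qed
qed

section \<open>Left translation on cosets and its completion\<close>

locale coset_completion = group \<Gamma> for \<Gamma> (structure) +
  fixes \<Lambda>
  assumes subgroup_\<Lambda>: "subgroup \<Lambda> \<Gamma>"
begin

abbreviation X where "X \<equiv> lcosets \<Lambda>"

abbreviation \<phi> where "\<phi> \<equiv> coset_action \<Gamma> \<Lambda>"

lemma coset_in: "g \<in> carrier \<Gamma> \<Longrightarrow> g <# \<Lambda> \<in> X"
  by (auto simp: LCOSETS_def)

lemma coset_obtain:
  assumes "C \<in> X" obtains g where "g \<in> carrier \<Gamma>" "C = g <# \<Lambda>"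
  using assms by (auto simp: LCOSETS_def)

lemma action_coset:
  "g \<in> carrier \<Gamma> \<Longrightarrow> h \<in> carrier \<Gamma> \<Longrightarrow> \<phi> g (h <# \<Lambda>) = (g \<otimes> h) <# \<Lambda>"
  using lcos_m_assoc[OF subgroup.subset[OF subgroup_\<Lambda>]]
  by (simp add: coset_action_def coset_in)

lemma coset_eqD:
  assumes "g \<in> carrier \<Gamma>" "h \<in> carrier \<Gamma>" "g <# \<Lambda> = h <# \<Lambda>"
  shows "inv g \<otimes> h \<in> \<Lambda>"
  using subgroup.lcos_module_imp[OF subgroup_\<Lambda> is_group, of g h] lcos_self[of h \<Lambda>] subgroup_\<Lambda> assms
  by simp

lemma coset_eqI:
  assumes "g \<in> carrier \<Gamma>" "l \<in> \<Lambda>"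
  shows "(g \<otimes> l) <# \<Lambda> = g <# \<Lambda>"
  using lcos_m_assoc[OF subgroup.subset[OF subgroup_\<Lambda>], of g l] assms
    coset_join3[of l \<Lambda>] subgroup_\<Lambda> subgroup.mem_carrier[OF subgroup_\<Lambda>]
  by simp

lemma action_in: "g \<in> carrier \<Gamma> \<Longrightarrow> C \<in> X \<Longrightarrow> \<phi> g C \<in> X"
  by (metis action_coset coset_obtain coset_in m_closed)

lemma action_mult:
  "g \<in> carrier \<Gamma> \<Longrightarrow> h \<in> carrier \<Gamma> \<Longrightarrow> C \<in> X \<Longrightarrow> \<phi> (g \<otimes> h) C = \<phi> g (\<phi> h C)"
  by (elim coset_obtain) (simp add: action_coset m_assoc)

lemma action_one: "C \<in> X \<Longrightarrow> \<phi> \<one> C = C"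
  by (elim coset_obtain) (simp add: action_coset)

lemma action_inv:
  assumes "g \<in> carrier \<Gamma>" "C \<in> X"
  shows "\<phi> g (\<phi> (inv g) C) = C" "\<phi> (inv g) (\<phi> g C) = C"
  using assms by (simp_all add: action_mult[symmetric] action_one)

lemma action_Bij: "g \<in> carrier \<Gamma> \<Longrightarrow> \<phi> g \<in> Bij X"
  unfolding Bij_def
proof
  assume g: "g \<in> carrier \<Gamma>"
  show "\<phi> g \<in> extensional X" by (simp add: coset_action_def)
  have "bij_betw (\<phi> g) X X"
    by (rule bij_betw_byWitness[where f' = "\<phi> (inv g)"]) (use g in \<open>auto simp: action_inv action_in\<close>)
  then show "\<phi> g \<in> {f. bij_betw f X X}" by simp
qed

lemma action_hom_BijGroup: "\<phi> \<in> hom \<Gamma> (BijGroup X)"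
proof (rule homI)
  fix g h assume g: "g \<in> carrier \<Gamma>" "h \<in> carrier \<Gamma>"
  show "\<phi> (g \<otimes> h) = \<phi> g \<otimes>\<^bsub>BijGroup X\<^esub> \<phi> h"
  proof (rule extensionalityI[of _ X])
    show "\<phi> (g \<otimes> h) \<in> extensional X" by (simp add: coset_action_def)
    show "\<phi> g \<otimes>\<^bsub>BijGroup X\<^esub> \<phi> h \<in> extensional X"
      using g by (simp add: BijGroup_def action_Bij)
  qed (use g in \<open>simp add: BijGroup_def action_Bij compose_eq action_mult\<close>)
qed (simp add: BijGroup_def action_Bij)

lemma subgroup_action_image: "subgroup (\<phi> ` carrier \<Gamma>) (BijGroup X)"
proof -
  interpret h: group_hom \<Gamma> "BijGroup X" \<phi>
    using action_hom_BijGroup group_BijGroup is_group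
    by (simp add: group_hom_def group_hom_axioms_def)
  show ?thesis by (rule h.img_is_subgroup)
qed

lemma carrier_schlichting:
  "carrier (schlichting \<Gamma> \<Lambda>) = sym_topology X closure_of (\<phi> ` carrier \<Gamma>)"
  by (simp add: schlichting_def)

sublocale permutation_group X "carrier (schlichting \<Gamma> \<Lambda>)"
  unfolding carrier_schlichting
  by (rule permutation_group.intro[OF subgroup_closure_of_sym_topology[OF subgroup_action_image]])

lemma schlichting_eq: "schlichting \<Gamma> \<Lambda> = G" "schlichting_topology \<Gamma> \<Lambda> = \<tau>"
  unfolding G_def \<tau>_def by (simp_all add: schlichting_def schlichting_topology_def)

lemma in_carrier_G_iff:
  "f \<in> carrier G \<longleftrightarrow> f \<in> Bij X \<and>
    (\<forall>F. finite F \<and> F \<subseteq> X \<longrightarrow> (\<exists>g\<in>carrier \<Gamma>. \<forall>C\<in>F. \<phi> g C = f C))"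
proof -
  have "\<phi> ` carrier \<Gamma> \<subseteq> Bij X" using action_Bij by auto
  from in_closure_of_sym_topology[OF this, of f] show ?thesis
    unfolding carrier_G unfolding carrier_schlichting by simp
qed

lemma action_closed: "g \<in> carrier \<Gamma> \<Longrightarrow> \<phi> g \<in> carrier G"
  unfolding in_carrier_G_iff using action_Bij by blast

lemma action_hom: "\<phi> \<in> hom \<Gamma> G"
proof (rule homI)
  fix g h assume g: "g \<in> carrier \<Gamma>" "h \<in> carrier \<Gamma>"
  then show "\<phi> (g \<otimes> h) = \<phi> g \<otimes>\<^bsub>G\<^esub> \<phi> h"
    by (intro ext) (simp_all add: action_closed mult_apply action_mult)
qed (simp add: action_closed)

sublocale action: group_hom \<Gamma> G \<phi>
  using action_hom is_group group_G by (simp add: group_hom_def group_hom_axioms_def)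

declare action.hom_inv [simp del] action.hom_mult [simp del]

text \<open>This is the density of the image of \<open>\<Gamma>\<close>. It turns statements about
  the completion into statements about group elements.\<close>

lemma approximation:
  assumes "f \<in> carrier G" "finite F" "F \<subseteq> X"
  obtains g where "g \<in> carrier \<Gamma>" "\<And>C. C \<in> F \<Longrightarrow> \<phi> g C = f C"
  using assms unfolding in_carrier_G_iff by meson

text \<open>A pointwise limit of bijections can fail to be surjective. The eventual values of the
  inverses supply a map \<open>y\<close>, and comparison at a common large index shows that it
  inverts \<open>x\<close>.\<close>

lemma limit_exists:
  assumes g: "\<And>n. g n \<in> carrier \<Gamma>"
    and const: "\<And>C. C \<in> X \<Longrightarrow> \<exists>D. \<forall>\<^sub>F n in sequentially. \<phi> (g n) C = D"
      "\<And>C. C \<in> X \<Longrightarrow> \<exists>D. \<forall>\<^sub>F n in sequentially. \<phi> (inv (g n)) C = D"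
  obtains x where "x \<in> carrier G" "\<And>C. C \<in> X \<Longrightarrow> \<forall>\<^sub>F n in sequentially. \<phi> (g n) C = x C"
proof -
  obtain x0 where x0: "\<And>C. C \<in> X \<Longrightarrow> \<forall>\<^sub>F n in sequentially. \<phi> (g n) C = x0 C"
    using const(1) by metis
  obtain y where y: "\<And>C. C \<in> X \<Longrightarrow> \<forall>\<^sub>F n in sequentially. \<phi> (inv (g n)) C = y C"
    using const(2) by metis
  \<comment> \<open>Elements of \<open>Bij X\<close> are extensional, whereas the chosen
    \<open>x0\<close> is arbitrary outside \<open>X\<close>.\<close>
  define x where "x = restrict x0 X"
  have x: "\<forall>\<^sub>F n in sequentially. \<phi> (g n) C = x C" if "C \<in> X" for C
    using x0[OF that] that by (simp add: x_def)
  have xX: "x C \<in> X" if C: "C \<in> X" for C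
    using eventually_happens'[OF sequentially_bot x[OF C]] action_in[OF g C] by metis
  have yX: "y C \<in> X" if C: "C \<in> X" for C
    using eventually_happens'[OF sequentially_bot y[OF C]] action_in[OF inv_closed[OF g] C] by metis
  have xy: "x (y C) = C" if C: "C \<in> X" for C
  proof -
    have "\<forall>\<^sub>F n in sequentially. x (y C) = C"
      using y[OF C] x[OF yX[OF C]] by eventually_elim (metis action_inv(1) g C)
    then show ?thesis by simp
  qed
  have yx: "y (x C) = C" if C: "C \<in> X" for C
  proof -
    have "\<forall>\<^sub>F n in sequentially. y (x C) = C"
      using x[OF C] y[OF xX[OF C]] by eventually_elim (metis action_inv(2) g C)
    then show ?thesis by simp
  qed
  have "bij_betw x X X"
    by (rule bij_betw_byWitness[where f' = y]) (use xX yX xy yx in auto)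
  then have "x \<in> Bij X" by (simp add: Bij_def x_def)
  moreover have "\<exists>h\<in>carrier \<Gamma>. \<forall>C\<in>F. \<phi> h C = x C" if "finite F" "F \<subseteq> X" for F
  proof -
    have "\<forall>\<^sub>F n in sequentially. \<forall>C\<in>F. \<phi> (g n) C = x C"
      using that x by (subst eventually_ball_finite_distrib) auto
    then obtain n where "\<forall>C\<in>F. \<phi> (g n) C = x C"
      using eventually_happens'[OF sequentially_bot] by blast
    then show ?thesis using g by blast
  qed
  ultimately have "x \<in> carrier G" unfolding in_carrier_G_iff by blast
  then show thesis using x that by blast
qed

section \<open>Contraction groups of conjugations\<close>

lemma conjugation_action_apply:
  assumes "s \<in> carrier \<Gamma>" "x \<in> carrier G" "C \<in> X"
  shows "conjugation G (\<phi> s) x C = \<phi> s (x (\<phi> (inv s) C))"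
proof -
  have "conjugation G (\<phi> s) x = \<phi> s \<otimes>\<^bsub>G\<^esub> x \<otimes>\<^bsub>G\<^esub> \<phi> (inv s)"
    using assms by (simp add: G.conjugation_apply action.hom_inv)
  then show ?thesis
    using assms by (simp add: mult_apply action_closed action_in)
qed

lemma contraction_group_iff:
  assumes s: "s \<in> carrier \<Gamma>"
  shows "x \<in> contraction_group G \<tau> (conjugation G (\<phi> s)) \<longleftrightarrow> x \<in> carrier G \<and>
    (\<forall>C\<in>X. \<forall>\<^sub>F n in sequentially. \<phi> (s [^] (n::nat)) (x (\<phi> (inv (s [^] n)) C)) = C)"
proof (cases "x \<in> carrier G")
  case True
  have pow: "conjugation G (\<phi> s) [^]\<^bsub>AutoGroup G\<^esub> n = conjugation G (\<phi> (s [^] n))" for n :: nat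
    using s by (simp add: G.conjugation_nat_pow action_closed action.hom_nat_pow)
  have "conjugation G (\<phi> (s [^] n)) x \<in> carrier G" for n :: nat
    using s True by (intro G.conjugation_closed action_closed) auto
  from limitin_\<tau>[where f = "\<lambda>n. conjugation G (\<phi> (s [^] (n::nat))) x", OF this] show ?thesis
    using s True by (simp add: contraction_group_def pow conjugation_action_apply one_apply
        cong: ball_cong)
qed (simp add: contraction_group_def)

text \<open>Conjugations by commuting elements commute, so the condition on the conjugate at
  \<open>C\<close> is the condition on \<open>x\<close> at \<open>\<phi> (inv g) C\<close>, moved by
  \<open>g\<close>. With \<open>g = t\<close> and \<open>s\<close> equal to \<open>t\<close> or
  \<open>inv t\<close>, this makes both contraction groups stable under conjugation by
  \<open>t\<close>.\<close>

lemma contraction_group_conjugate: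
  assumes s: "s \<in> carrier \<Gamma>" and g: "g \<in> carrier \<Gamma>" and comm: "g \<otimes> s = s \<otimes> g"
    and x: "x \<in> contraction_group G \<tau> (conjugation G (\<phi> s))"
  shows "conjugation G (\<phi> g) x \<in> contraction_group G \<tau> (conjugation G (\<phi> s))"
  unfolding contraction_group_iff[OF s]
proof (intro conjI ballI)
  have xG: "x \<in> carrier G" using x by (simp add: contraction_group_def)
  then show "conjugation G (\<phi> g) x \<in> carrier G"
    using g by (intro G.conjugation_closed action_closed)
  fix C assume C: "C \<in> X"
  have comm': "s [^] n \<otimes> g = g \<otimes> s [^] n" for n :: nat
    using comm s g by (metis group_commutes_pow)
  have *: "\<phi> (s [^] n) (\<phi> g D) = \<phi> g (\<phi> (s [^] n) D)" if "D \<in> X" for D and n :: nat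
    using that s g comm'[of n] by (simp add: action_mult[symmetric])
  have "inv g \<otimes> inv (s [^] n) = inv (s [^] n) \<otimes> inv g" for n :: nat
    using comm'[of n] s g by (metis inv_mult_group nat_pow_closed)
  then have **: "\<phi> (inv g) (\<phi> (inv (s [^] n)) C) = \<phi> (inv (s [^] n)) (\<phi> (inv g) C)" for n :: nat
    using C s g by (simp add: action_mult[symmetric])
  have "\<forall>\<^sub>F n in sequentially. \<phi> (s [^] (n::nat)) (x (\<phi> (inv (s [^] n)) (\<phi> (inv g) C))) = \<phi> (inv g) C"
    using x C g action_in unfolding contraction_group_iff[OF s] by blast
  then show "\<forall>\<^sub>F n in sequentially. \<phi> (s [^] (n::nat))
      (conjugation G (\<phi> g) x (\<phi> (inv (s [^] n)) C)) = C"
  proof eventually_elim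
    case (elim n)
    have "conjugation G (\<phi> g) x (\<phi> (inv (s [^] n)) C)
        = \<phi> g (x (\<phi> (inv (s [^] n)) (\<phi> (inv g) C)))"
      using s g C xG by (simp add: conjugation_action_apply action_in **)
    moreover have "x (\<phi> (inv (s [^] n)) (\<phi> (inv g) C)) \<in> X"
      using s g C by (intro image_in[OF xG] action_in) auto
    ultimately show ?case
      using elim g C by (simp add: * action_inv)
  qed
qed

end

section \<open>Homomorphisms out of a presented group\<close>

fun word_eval :: "('a, 'b) monoid_scheme \<Rightarrow> ('g \<Rightarrow> 'a) \<Rightarrow> 'g word \<Rightarrow> 'a" where
  "word_eval H f [] = \<one>\<^bsub>H\<^esub>"
| "word_eval H f ((x, b) # w) = (if b then f x else inv\<^bsub>H\<^esub> (f x)) \<otimes>\<^bsub>H\<^esub> word_eval H f w"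

context group
begin

lemma word_eval_closed: "range f \<subseteq> carrier G \<Longrightarrow> word_eval G f w \<in> carrier G"
proof (induction w)
  case (Cons y w)
  then show ?case by (cases y) auto
qed simp

lemma word_eval_append:
  assumes "range f \<subseteq> carrier G"
  shows "word_eval G f (u @ v) = word_eval G f u \<otimes> word_eval G f v"
proof (induction u)
  case (Cons y u)
  obtain x b where "y = (x, b)" by (cases y)
  moreover have "f x \<in> carrier G" using assms by auto
  ultimately show ?case using Cons word_eval_closed[OF assms] by (simp add: m_assoc)
qed (simp add: word_eval_closed[OF assms])

lemma word_eval_replicate:
  assumes "range f \<subseteq> carrier G"
  shows "word_eval G f (replicate n (x, True)) = f x [^] n"
proof (induction n)
  case (Suc n)
  have "f x \<in> carrier G" using assms by auto
  then show ?case using Suc nat_pow_Suc2[of "f x" n] by simp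
qed simp

lemma word_eval_pres_eq:
  assumes f: "range f \<subseteq> carrier G"
    and rels: "\<And>l r. (l, r) \<in> R \<Longrightarrow> word_eval G f l = word_eval G f r"
    and eq: "pres_eq R u v"
  shows "word_eval G f u = word_eval G f v"
  using eq
proof (induction rule: pres_eq.induct)
  case (cancel u x b v)
  have "f x \<in> carrier G" using f by auto
  then have "word_eval G f [(x, b), (x, \<not> b)] = \<one>" by simp
  then show ?case
    by (simp only: word_eval_append[OF f] l_one word_eval_closed[OF f])
qed (simp_all add: word_eval_append[OF f] rels)

text \<open>The universal property of a presentation. A class is evaluated at an arbitrary
  representative, and \<open>word_eval_pres_eq\<close> shows that the choice does not
  matter.\<close>

lemma presented_group_hom:
  assumes f: "range f \<subseteq> carrier G"
    and rels: "\<And>l r. (l, r) \<in> R \<Longrightarrow> word_eval G f l = word_eval G f r"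
  obtains h where "h \<in> hom (presented_group R) G" "\<And>x. h (pres_class R [(x, True)]) = f x"
proof
  define h where "h X = word_eval G f (SOME w. w \<in> X)" for X
  have h: "h (pres_class R w) = word_eval G f w" for w
  proof -
    have "w \<in> pres_class R w" by (simp add: pres_class_def pres_eq.refl)
    then have "(SOME v. v \<in> pres_class R w) \<in> pres_class R w" by (rule someI)
    then have "pres_eq R w (SOME v. v \<in> pres_class R w)" by (simp add: pres_class_def)
    from word_eval_pres_eq[OF f rels this] show ?thesis by (simp add: h_def)
  qed
  show "h \<in> hom (presented_group R) G"
    by (rule homI)
      (auto simp: presented_group_simps presented_group_mult h word_eval_append[OF f]
        word_eval_closed[OF f])
  show "h (pres_class R [(x, True)]) = f x" for x
  proof -
    have "f x \<in> carrier G" using f by auto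
    then show ?thesis by (simp add: h)
  qed
qed

end

section \<open>The Baumslag--Solitar group\<close>

context
  fixes p q :: nat
begin

lemma group_BS: "group (BS p q)"
  by (simp add: BS_def group_presented_group)

interpretation BS: group "BS p q"
  by (rule group_BS)

lemma BS_mult:
  "pres_class (bs_rels p q) u \<otimes>\<^bsub>BS p q\<^esub> pres_class (bs_rels p q) v = pres_class (bs_rels p q) (u @ v)"
  by (simp add: BS_def presented_group_mult)

lemma pres_class_in_BS: "pres_class (bs_rels p q) w \<in> carrier (BS p q)"
  by (simp add: BS_def presented_group_simps)

lemma one_BS: "\<one>\<^bsub>BS p q\<^esub> = pres_class (bs_rels p q) []"
  by (simp add: BS_def presented_group_simps)

lemma bs_a_closed: "bs_a p q \<in> carrier (BS p q)" and bs_t_closed: "bs_t p q \<in> carrier (BS p q)"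
  by (simp_all add: bs_a_def bs_t_def pres_class_in_BS)

lemma inv_generator_BS:
  "inv\<^bsub>BS p q\<^esub> (pres_class (bs_rels p q) [(x, True)]) = pres_class (bs_rels p q) [(x, False)]"
  using pres_eq.cancel[of "bs_rels p q" "[]" x False "[]"]
  by (intro BS.inv_equality) (simp_all add: BS_mult pres_class_in_BS one_BS pres_class_eq_iff)

lemma replicate_BS:
  "pres_class (bs_rels p q) (replicate n (x, True)) = pres_class (bs_rels p q) [(x, True)] [^]\<^bsub>BS p q\<^esub> n"
proof (induction n)
  case (Suc n)
  then show ?case
    using BS_mult[of "replicate n (x, True)" "[(x, True)]"]
    by (simp add: replicate_append_same)
qed (simp add: one_BS)

lemma BS_relation:
  "bs_t p q \<otimes>\<^bsub>BS p q\<^esub> (bs_a p q [^]\<^bsub>BS p q\<^esub> p) \<otimes>\<^bsub>BS p q\<^esub> inv\<^bsub>BS p q\<^esub> (bs_t p q)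
    = bs_a p q [^]\<^bsub>BS p q\<^esub> q"
proof -
  have "pres_eq (bs_rels p q) ([(T, True)] @ replicate p (A, True) @ [(T, False)]) (replicate q (A, True))"
    using pres_eq.rel[of _ "replicate q (A, True)" "bs_rels p q" "[]" "[]"] by (simp add: bs_rels_def)
  then show ?thesis
    by (simp add: bs_a_def bs_t_def inv_generator_BS BS_mult pres_class_eq_iff flip: replicate_BS)
qed

text \<open>Induction over a representing word, stated without words. Letters are added on the left
  because powers of \<open>a\<close> will be moved past them from the left.\<close>

lemma BS_induct [consumes 1, case_names one a inv_a t inv_t]:
  assumes "g \<in> carrier (BS p q)" and "P \<one>\<^bsub>BS p q\<^esub>"
    and "\<And>g. g \<in> carrier (BS p q) \<Longrightarrow> P g \<Longrightarrow> P (bs_a p q \<otimes>\<^bsub>BS p q\<^esub> g)"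
    and "\<And>g. g \<in> carrier (BS p q) \<Longrightarrow> P g \<Longrightarrow> P (inv\<^bsub>BS p q\<^esub> (bs_a p q) \<otimes>\<^bsub>BS p q\<^esub> g)"
    and "\<And>g. g \<in> carrier (BS p q) \<Longrightarrow> P g \<Longrightarrow> P (bs_t p q \<otimes>\<^bsub>BS p q\<^esub> g)"
    and "\<And>g. g \<in> carrier (BS p q) \<Longrightarrow> P g \<Longrightarrow> P (inv\<^bsub>BS p q\<^esub> (bs_t p q) \<otimes>\<^bsub>BS p q\<^esub> g)"
  shows "P g"
proof -
  have "P (pres_class (bs_rels p q) w)" for w
  proof (induction w)
    case (Cons y w)
    have "pres_class (bs_rels p q) (y # w)
        = pres_class (bs_rels p q) [y] \<otimes>\<^bsub>BS p q\<^esub> pres_class (bs_rels p q) w"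
      by (simp add: BS_mult)
    moreover obtain x b where "y = (x, b)" by (cases y)
    ultimately show ?case
      using assms(3-6)[OF pres_class_in_BS Cons]
      by (cases x; cases b) (simp_all add: bs_a_def bs_t_def inv_generator_BS)
  qed (use assms(2) in \<open>simp add: one_BS\<close>)
  then show ?thesis using assms(1) by (auto simp: BS_def presented_group_simps)
qed

text \<open>The relation is required in a form without inverses, which is easy to check for concrete
  bijections.\<close>

lemma BS_hom:
  assumes H: "group H" and uv: "u \<in> carrier H" "v \<in> carrier H"
    and rel: "v \<otimes>\<^bsub>H\<^esub> (u [^]\<^bsub>H\<^esub> p) = (u [^]\<^bsub>H\<^esub> q) \<otimes>\<^bsub>H\<^esub> v"
  obtains h where "group_hom (BS p q) H h" "h (bs_a p q) = u" "h (bs_t p q) = v"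
proof -
  interpret H: group H by (rule H)
  define f where "f x = (case x of A \<Rightarrow> u | T \<Rightarrow> v)" for x
  have f: "range f \<subseteq> carrier H" using uv by (auto simp: f_def split: bs_gen.splits)
  have "word_eval H f ([(T, True)] @ replicate p (A, True) @ [(T, False)])
      = v \<otimes>\<^bsub>H\<^esub> (u [^]\<^bsub>H\<^esub> p \<otimes>\<^bsub>H\<^esub> inv\<^bsub>H\<^esub> v)"
    unfolding H.word_eval_append[OF f] H.word_eval_replicate[OF f] using uv by (simp add: f_def)
  also have "\<dots> = u [^]\<^bsub>H\<^esub> q"
    using uv rel by (simp add: H.m_assoc[symmetric]) (simp add: H.m_assoc)
  finally obtain h where "h \<in> hom (BS p q) H" "\<And>x. h (pres_class (bs_rels p q) [(x, True)]) = f x"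
    using H.presented_group_hom[OF f, of "bs_rels p q"] uv H.word_eval_replicate[OF f, of q A]
    unfolding BS_def by (auto simp: bs_rels_def f_def)
  then show thesis
    by (intro that[of h])
      (simp_all add: group_hom_def group_hom_axioms_def group_BS H bs_a_def bs_t_def f_def)
qed

end

section \<open>Two actions on the rationals\<close>

text \<open>A homomorphism from the integers is determined by its value at 1. This computes the
  powers of a translation.\<close>

lemma (in group) int_pow_eqI:
  fixes f :: "int \<Rightarrow> 'a"
  assumes add: "\<And>i j. f (i + j) = f i \<otimes> f j" and closed: "\<And>i. f i \<in> carrier G"
  shows "f 1 [^] k = f k"
proof (induction k rule: int_induct[where k = 0])
  case base
  have "f 0 \<otimes> f 0 = f 0" using add[of 0 0] by simp
  then show ?case using closed[of 0] by simp
next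
  case (step1 i)
  then show ?case using closed[of 1] add[of i 1] by (simp add: int_pow_mult)
next
  case (step2 i)
  have "f 1 [^] (i - 1) \<otimes> f 1 = f (i - 1) \<otimes> f 1"
    using step2 closed[of 1] add[of "i - 1" 1] int_pow_mult[of "f 1" "i - 1" 1] by simp
  then show ?case using closed by (metis int_pow_closed right_cancel)
qed

lemma BijGroup_UNIV:
  "f \<in> carrier (BijGroup UNIV) \<longleftrightarrow> bij f"
  "bij f \<Longrightarrow> bij g \<Longrightarrow> f \<otimes>\<^bsub>BijGroup UNIV\<^esub> g = f \<circ> g"
  "\<one>\<^bsub>BijGroup UNIV\<^esub> = id"
  by (auto simp: BijGroup_def Bij_def compose_def restrict_def)

lemma bij_translation: "bij (\<lambda>x::'a::group_add. x + c)"
  by (rule bijI') (auto intro: exI[of _ "_ - c"])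

lemma translation_int_pow:
  "(\<lambda>x::rat. x + 1) [^]\<^bsub>BijGroup UNIV\<^esub> (k::int) = (\<lambda>x. x + of_int k)"
  using group.int_pow_eqI[OF group_BijGroup, of "\<lambda>k x. x + of_int k :: rat" UNIV k]
  by (simp add: BijGroup_UNIV bij_translation fun_eq_iff)

lemma translation_nat_pow:
  "(\<lambda>x::rat. x + 1) [^]\<^bsub>BijGroup UNIV\<^esub> (n::nat) = (\<lambda>x. x + of_nat n)"
  using translation_int_pow[of "int n"] by (simp add: int_pow_int)

text \<open>When \<open>a\<close> acts as translation by 1, the relation says only that
  \<open>v\<close> carries translation by \<open>p\<close> to translation by \<open>q\<close>. This
  leaves much freedom in \<open>v\<close>, and two choices are used below.\<close>

lemma BS_rat_action:
  assumes v: "bij v" and shift: "\<And>x. v (x + of_nat p) = v x + of_nat q"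
  obtains h where "group_hom (BS p q) (BijGroup (UNIV :: rat set)) h"
    "\<And>k::int. h (bs_a p q [^]\<^bsub>BS p q\<^esub> k) = (\<lambda>x. x + of_int k)" "h (bs_t p q) = v"
proof -
  have "v \<otimes>\<^bsub>BijGroup UNIV\<^esub> ((\<lambda>x::rat. x + 1) [^]\<^bsub>BijGroup UNIV\<^esub> p)
      = ((\<lambda>x::rat. x + 1) [^]\<^bsub>BijGroup UNIV\<^esub> q) \<otimes>\<^bsub>BijGroup UNIV\<^esub> v"
    using v shift by (simp add: BijGroup_UNIV translation_nat_pow bij_translation fun_eq_iff)
  then obtain h where h: "group_hom (BS p q) (BijGroup (UNIV :: rat set)) h"
      "h (bs_a p q) = (\<lambda>x. x + 1)" "h (bs_t p q) = v"
    using BS_hom[OF group_BijGroup, of "\<lambda>x::rat. x + 1" UNIV v p q] v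
    by (auto simp: BijGroup_UNIV bij_translation)
  moreover have "h (bs_a p q [^]\<^bsub>BS p q\<^esub> k) = (\<lambda>x. x + of_int k)" for k :: int
    using group_hom.hom_int_pow[OF h(1) bs_a_closed, of k] h(2) by (simp add: translation_int_pow)
  ultimately show thesis using that by blast
qed

lemma group_hom_BijGroup_UNIV:
  assumes "group_hom G (BijGroup UNIV) h"
  shows "x \<in> carrier G \<Longrightarrow> y \<in> carrier G \<Longrightarrow> h (x \<otimes>\<^bsub>G\<^esub> y) z = h x (h y z)"
    and "h \<one>\<^bsub>G\<^esub> z = z"
proof -
  interpret group_hom G "BijGroup UNIV" h by (rule assms)
  show "h (x \<otimes>\<^bsub>G\<^esub> y) z = h x (h y z)" if "x \<in> carrier G" "y \<in> carrier G"
    using that hom_closed[of x] hom_closed[of y] by (simp add: BijGroup_UNIV)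
  show "h \<one>\<^bsub>G\<^esub> z = z" by (simp add: BijGroup_UNIV)
qed

section \<open>Moving powers of the generators past each other\<close>

locale baumslag_solitar = group \<Gamma> for \<Gamma> (structure) +
  fixes p q :: nat
  assumes prime_p: "prime p" and prime_q: "prime q" and p_neq_q: "p \<noteq> q"
    and \<Gamma>_eq: "\<Gamma> = BS p q"
begin

abbreviation a where "a \<equiv> bs_a p q"
abbreviation t where "t \<equiv> bs_t p q"
abbreviation \<Lambda> where "\<Lambda> \<equiv> generate \<Gamma> {a}"

lemmas a_closed [simp] = bs_a_closed[of p q, folded \<Gamma>_eq]
lemmas t_closed [simp] = bs_t_closed[of p q, folded \<Gamma>_eq]
lemmas relation = BS_relation[of p q, folded \<Gamma>_eq]
lemmas rat_action = BS_rat_action[of _ p q, folded \<Gamma>_eq]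

sublocale coset_completion \<Gamma> \<Lambda>
  by (rule coset_completion.intro[OF is_group])
    (simp add: coset_completion_axioms_def generate_is_subgroup)

lemma p_pos: "0 < p" and q_pos: "0 < q"
  using prime_p prime_q by (auto simp: prime_gt_0_nat)

lemma coprime_pq: "coprime (int p ^ m) (int q ^ n)"
  using primes_coprime[OF prime_p prime_q p_neq_q] by simp

lemma in_\<Lambda>_iff: "g \<in> \<Lambda> \<longleftrightarrow> (\<exists>k::int. g = a [^] k)"
  by (auto simp: generate_pow)

text \<open>Conjugation by \<open>t\<close> is a homomorphism, so the defining relation passes to
  \<open>k\<close>-th powers.\<close>

lemma t_a_pow: "t \<otimes> a [^] (int p * k) = a [^] (int q * k) \<otimes> t"
proof -
  have hom: "conjugation \<Gamma> t \<in> hom \<Gamma> \<Gamma>"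
    using conjugation_in_auto[of t] by (simp add: auto_def)
  have "conjugation \<Gamma> t (a [^] (int p * k)) = conjugation \<Gamma> t (a [^] p) [^] k"
    using hom_int_pow[OF hom _ is_group is_group, of "a [^] p" k]
    by (simp add: int_pow_pow[symmetric] int_pow_int)
  also have "conjugation \<Gamma> t (a [^] p) = a [^] q"
    using relation by (simp add: conjugation_apply)
  also have "(a [^] q) [^] k = a [^] (int q * k)"
    by (simp add: int_pow_pow[symmetric] int_pow_int)
  finally have "t \<otimes> a [^] (int p * k) \<otimes> inv t = a [^] (int q * k)"
    by (simp add: conjugation_apply)
  then show ?thesis by (simp add: inv_solve_right')
qed

lemma t_pow_a_pow: "t [^] n \<otimes> a [^] (int p ^ n * k) = a [^] (int q ^ n * k) \<otimes> t [^] n"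
proof (induction n arbitrary: k)
  case (Suc n)
  have "t [^] Suc n \<otimes> a [^] (int p ^ Suc n * k) = t [^] n \<otimes> (t \<otimes> a [^] (int p * (int p ^ n * k)))"
    by (simp add: m_assoc mult.assoc)
  also have "\<dots> = t [^] n \<otimes> a [^] (int p ^ n * (int q * k)) \<otimes> t"
    by (simp add: t_a_pow m_assoc mult.left_commute)
  also have "\<dots> = a [^] (int q ^ n * (int q * k)) \<otimes> t [^] n \<otimes> t"
    by (simp only: Suc.IH)
  also have "\<dots> = a [^] (int q ^ Suc n * k) \<otimes> t [^] Suc n"
    by (simp add: m_assoc mult.left_commute mult.assoc)
  finally show ?case .
qed simp

lemma inv_t_pow_a_pow:
  "inv t [^] n \<otimes> a [^] (int q ^ n * k) = a [^] (int p ^ n * k) \<otimes> inv t [^] n"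
proof -
  have "a [^] (int q ^ n * k) = t [^] n \<otimes> (a [^] (int p ^ n * k) \<otimes> inv (t [^] n))"
    using t_pow_a_pow[of n k] by (simp add: m_assoc[symmetric] inv_solve_right)
  then have "inv (t [^] n) \<otimes> a [^] (int q ^ n * k) = a [^] (int p ^ n * k) \<otimes> inv (t [^] n)"
    by (simp add: inv_solve_left')
  then show ?thesis by (simp add: nat_pow_inv)
qed

section \<open>Divisibility of exponents and stabilizers of cosets\<close>

lemma affine_action:
  obtains h where "group_hom \<Gamma> (BijGroup (UNIV :: rat set)) h"
    "\<And>k::int. h (a [^] k) = (\<lambda>x. x + of_int k)"
    "\<And>n. h (t [^] n) = (\<lambda>x. (of_nat q / of_nat p) ^ n * x)"
proof -
  let ?v = "\<lambda>x::rat. of_nat q / of_nat p * x"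
  have "bij ?v"
    by (rule o_bij[of "\<lambda>x. of_nat p / of_nat q * x"]) (use p_pos q_pos in \<open>auto simp: fun_eq_iff\<close>)
  moreover have "?v (x + of_nat p) = ?v x + of_nat q" for x
    using p_pos by (simp add: field_simps)
  ultimately obtain h where h: "group_hom \<Gamma> (BijGroup (UNIV :: rat set)) h"
    "\<And>k::int. h (a [^] k) = (\<lambda>x. x + of_int k)" "h t = ?v"
    using rat_action by metis
  have "h (t [^] n) = (\<lambda>x. (of_nat q / of_nat p) ^ n * x)" for n
  proof (induction n)
    case 0
    then show ?case using group_hom_BijGroup_UNIV(2)[OF h(1)] by auto
  next
    case (Suc n)
    then show ?case
      by (simp add: group_hom_BijGroup_UNIV(1)[OF h(1)] h(3) fun_eq_iff)
  qed
  with h(1,2) show thesis using that by blast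
qed

text \<open>Fixing the coset means \<open>a^k t^n = t^n a^m\<close> for some \<open>m\<close>.
  Evaluation at 0 in the affine action gives \<open>k p^n = q^n m\<close>, and \<open>p^n\<close>
  and \<open>q^n\<close> are coprime.\<close>

lemma q_pow_dvd_of_fixes:
  assumes "(a [^] (k::int) \<otimes> t [^] n) <# \<Lambda> = t [^] n <# \<Lambda>"
  shows "int q ^ n dvd k"
proof -
  obtain h where h: "group_hom \<Gamma> (BijGroup (UNIV :: rat set)) h"
    "\<And>k::int. h (a [^] k) = (\<lambda>x. x + of_int k)"
    "\<And>n. h (t [^] n) = (\<lambda>x. (of_nat q / of_nat p) ^ n * x)"
    using affine_action by blast
  have "inv (t [^] n) \<otimes> (a [^] k \<otimes> t [^] n) \<in> \<Lambda>"
    using assms by (intro coset_eqD) simp_all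
  then obtain m where "inv (t [^] n) \<otimes> (a [^] k \<otimes> t [^] n) = a [^] (m::int)"
    by (auto simp: in_\<Lambda>_iff)
  then have "a [^] k \<otimes> t [^] n = t [^] n \<otimes> a [^] m"
    by (simp add: inv_solve_left')
  from arg_cong[OF this, of "\<lambda>g. h g 0"]
  have "rat_of_int k = (of_nat q / of_nat p) ^ n * of_int m"
    by (simp add: group_hom_BijGroup_UNIV(1)[OF h(1)] h)
  then have "rat_of_int (k * int p ^ n) = rat_of_int (int q ^ n * m)"
    using p_pos by (simp add: field_simps)
  then have "k * int p ^ n = int q ^ n * m" by (simp only: of_int_eq_iff)
  then have "int q ^ n dvd k * int p ^ n" by simp
  then show ?thesis
    using coprime_pq[of n n] by (simp add: coprime_dvd_mult_left_iff coprime_commute)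
qed

text \<open>Here the equation is \<open>t^n a^k = a^m t^n\<close>, which evaluates at 0 to
  \<open>q^n k = m p^n\<close>.\<close>

lemma p_pow_dvd_of_fixes:
  assumes "(a [^] (k::int) \<otimes> inv (t [^] n)) <# \<Lambda> = inv (t [^] n) <# \<Lambda>"
  shows "int p ^ n dvd k"
proof -
  obtain h where h: "group_hom \<Gamma> (BijGroup (UNIV :: rat set)) h"
    "\<And>k::int. h (a [^] k) = (\<lambda>x. x + of_int k)"
    "\<And>n. h (t [^] n) = (\<lambda>x. (of_nat q / of_nat p) ^ n * x)"
    using affine_action by blast
  have "inv (inv (t [^] n)) \<otimes> (a [^] k \<otimes> inv (t [^] n)) \<in> \<Lambda>"
    using assms by (intro coset_eqD) simp_all
  then obtain m where "t [^] n \<otimes> (a [^] k \<otimes> inv (t [^] n)) = a [^] (m::int)"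
    by (auto simp: in_\<Lambda>_iff)
  then have "t [^] n \<otimes> a [^] k = a [^] m \<otimes> t [^] n"
    by (simp add: inv_solve_right' m_assoc[symmetric])
  from arg_cong[OF this, of "\<lambda>g. h g 0"]
  have "(of_nat q / of_nat p) ^ n * of_int k = rat_of_int m"
    by (simp add: group_hom_BijGroup_UNIV(1)[OF h(1)] h)
  then have "rat_of_int (int q ^ n * k) = rat_of_int (m * int p ^ n)"
    using p_pos by (simp add: field_simps)
  then have "int q ^ n * k = m * int p ^ n" by (simp only: of_int_eq_iff)
  then have "int p ^ n dvd int q ^ n * k" by simp
  then show ?thesis
    using coprime_pq[of n n] by (simp add: coprime_dvd_mult_right_iff)
qed

text \<open>A quantitative form of commensuration. Moving a power of \<open>a\<close> past a letter
  \<open>a\<close> or \<open>inv a\<close> changes nothing. Past \<open>t\<close> it trades a factor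
  \<open>q\<close> of the exponent for \<open>p\<close>, and past \<open>inv t\<close> a factor
  \<open>p\<close> for \<open>q\<close>. One more factor \<open>p * q\<close> pays for either, so
  \<open>N\<close> grows by one.\<close>

lemma power_fixes_coset:
  assumes "g \<in> carrier \<Gamma>"
  obtains N where "\<And>k. (int p * int q) ^ N dvd k \<Longrightarrow> (a [^] (k::int) \<otimes> g) <# \<Lambda> = g <# \<Lambda>"
proof -
  define fixes_by where "fixes_by g k \<longleftrightarrow> (a [^] (k::int) \<otimes> g) <# \<Lambda> = g <# \<Lambda>" for g k
  \<comment> \<open>If \<open>a^k\<close> becomes \<open>a^l\<close> on passing \<open>s\<close>,
    then \<open>a^k\<close> fixes the coset of \<open>s \<otimes> g\<close> as soon as
    \<open>a^l\<close> fixes that of \<open>g\<close>.\<close>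
  have step: "fixes_by (s \<otimes> g) k"
    if "s \<in> carrier \<Gamma>" "g \<in> carrier \<Gamma>" "a [^] k \<otimes> s = s \<otimes> a [^] l" "fixes_by g l" for s g k l
  proof -
    have "a [^] k \<otimes> (s \<otimes> g) = s \<otimes> (a [^] l \<otimes> g)"
      using that by (simp add: m_assoc[symmetric])
    moreover have "(s \<otimes> (a [^] l \<otimes> g)) <# \<Lambda> = \<phi> s (g <# \<Lambda>)"
      using that action_coset[of s "a [^] l \<otimes> g"] by (simp add: fixes_by_def)
    ultimately show ?thesis using that by (simp add: fixes_by_def action_coset)
  qed
  have "\<exists>N. \<forall>k. (int p * int q) ^ N dvd k \<longrightarrow> fixes_by g k"
    using assms
  proof (induction rule: BS_induct[of _ p q, folded \<Gamma>_eq, consumes 1, case_names one a inv_a t inv_t])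
    case one
    have "fixes_by \<one> k" for k
    proof -
      have "a [^] k \<in> \<Lambda>" by (auto simp: in_\<Lambda>_iff)
      from coset_eqI[OF one_closed this] show ?thesis by (simp add: fixes_by_def)
    qed
    then show ?case by blast
  next
    case (a g)
    then obtain N where N: "\<And>k. (int p * int q) ^ N dvd k \<Longrightarrow> fixes_by g k" by blast
    have "fixes_by (a \<otimes> g) k" if "(int p * int q) ^ N dvd k" for k
    proof (rule step[OF _ a(1) _ N[OF that]])
      show "a [^] k \<otimes> a = a \<otimes> a [^] k"
        using int_pow_mult[of a k 1] int_pow_mult[of a 1 k] by (simp add: add.commute)
    qed simp
    then show ?case by blast
  next
    case (inv_a g)
    then obtain N where N: "\<And>k. (int p * int q) ^ N dvd k \<Longrightarrow> fixes_by g k" by blast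
    have "fixes_by (inv a \<otimes> g) k" if "(int p * int q) ^ N dvd k" for k
    proof (rule step[OF _ inv_a(1) _ N[OF that]])
      show "a [^] k \<otimes> inv a = inv a \<otimes> a [^] k"
        using int_pow_mult[of a k "-1"] int_pow_mult[of a "-1" k]
        by (simp add: add.commute int_pow_neg)
    qed simp
    then show ?case by blast
  next
    case (t g)
    then obtain N where N: "\<And>k. (int p * int q) ^ N dvd k \<Longrightarrow> fixes_by g k" by blast
    have "fixes_by (t \<otimes> g) k" if "(int p * int q) ^ Suc N dvd k" for k
    proof -
      from that obtain m where m: "k = (int p * int q) ^ Suc N * m" ..
      have "a [^] k \<otimes> t = t \<otimes> a [^] (int p * ((int p * int q) ^ N * (int p * m)))"
        unfolding t_a_pow m by (simp add: mult_ac)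
      then show ?thesis by (rule step[rotated 2]) (use t(1) in \<open>auto intro: N\<close>)
    qed
    then show ?case by blast
  next
    case (inv_t g)
    then obtain N where N: "\<And>k. (int p * int q) ^ N dvd k \<Longrightarrow> fixes_by g k" by blast
    have "fixes_by (inv t \<otimes> g) k" if "(int p * int q) ^ Suc N dvd k" for k
    proof -
      from that obtain m where m: "k = (int p * int q) ^ Suc N * m" ..
      have "a [^] k \<otimes> inv t = inv t \<otimes> a [^] (int q * ((int p * int q) ^ N * (int q * m)))"
        using inv_t_pow_a_pow[of 1 "(int p * int q) ^ N * (int q * m)"] unfolding m
        by (simp add: mult_ac)
      then show ?thesis by (rule step[rotated 2]) (use inv_t(1) in \<open>auto intro: N\<close>)
    qed
    then show ?case by blast
  qed
  then show thesis using that unfolding fixes_by_def by blast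
qed

text \<open>
  The affine action does not see this, since there \<open>t a t\<^sup>-\<^sup>1\<close> is a translation. So the scaling
  by \<open>q / p\<close> is composed with the bijection that shifts \<open>p \<int>\<close> by \<open>p\<close> and fixes all other
  rationals, which commutes with the translation by \<open>p\<close> but not with the one by \<open>1\<close>.
\<close>

lemma t_a_inv_t_not_commutes_a: "(t \<otimes> a \<otimes> inv t) \<otimes> a \<noteq> a \<otimes> (t \<otimes> a \<otimes> inv t)"
proof
  assume comm: "(t \<otimes> a \<otimes> inv t) \<otimes> a = a \<otimes> (t \<otimes> a \<otimes> inv t)"
  let ?p = "rat_of_nat p" and ?q = "rat_of_nat q"
  have pq: "?p > 0" "?q > 0" using p_pos q_pos by auto
  \<comment> \<open>In the coordinate \<open>x / p\<close>, this moves every integer up by 1, fixes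
    all other rationals, and then scales by \<open>q\<close>.\<close>
  define v where "v x = ?q * (x / ?p + (if x / ?p \<in> \<int> then 1 else 0))" for x
  have bij: "bij v"
  proof (rule o_bij)
    let ?w = "\<lambda>x. ?p * (x / ?q - (if x / ?q \<in> \<int> then 1 else 0))"
    show "?w \<circ> v = id" "v \<circ> ?w = id"
      using pq by (auto simp: fun_eq_iff v_def)
  qed
  have "v (x + ?p) = v x + ?q" for x
    using pq by (simp add: v_def add_divide_distrib distrib_left)
  with bij obtain h where h: "group_hom \<Gamma> (BijGroup (UNIV :: rat set)) h"
    "\<And>k::int. h (a [^] k) = (\<lambda>x. x + of_int k)" "h t = v"
    using rat_action by metis
  have ha: "h a = (\<lambda>x. x + 1)" using h(2)[of 1] by simp
  note hm = group_hom_BijGroup_UNIV(1)[OF h(1)]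
  \<comment> \<open>After multiplication by \<open>t\<close> on the right, the inverse of
    \<open>t\<close> occurs only inside \<open>c\<close>. Since
    \<open>t \<otimes> c = a \<otimes> t\<close> and \<open>v\<close> is injective,
    \<open>h c\<close> can be found without inverting \<open>v\<close>.\<close>
  define c where "c = inv t \<otimes> a \<otimes> t"
  have c: "c \<in> carrier \<Gamma>" by (simp add: c_def)
  have tc: "t \<otimes> c = a \<otimes> t"
    by (simp add: c_def m_assoc[symmetric])
  have "(t \<otimes> a \<otimes> inv t) \<otimes> a \<otimes> t = t \<otimes> a \<otimes> c"
    by (simp add: c_def m_assoc)
  moreover have "a \<otimes> (t \<otimes> a \<otimes> inv t) \<otimes> t = a \<otimes> t \<otimes> a"
    by (simp add: m_assoc)
  ultimately have tac: "t \<otimes> a \<otimes> c = a \<otimes> t \<otimes> a" using comm by simp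
  have inverse_notin: "1 / rat_of_nat r \<notin> \<int>" if "prime r" for r
  proof
    assume "1 / rat_of_nat r \<in> \<int>"
    then obtain m where "1 / rat_of_nat r = of_int m" by (auto elim: Ints_cases)
    then have "rat_of_int 1 = rat_of_int (m * int r)"
      using that by (simp add: field_simps prime_gt_0_nat)
    then have "int r dvd 1" by (metis dvd_triv_right of_int_eq_iff)
    then show False using that by simp
  qed
  have sum_notin: "1 / ?p + 1 / ?q \<notin> \<int>"
  proof
    assume "1 / ?p + 1 / ?q \<in> \<int>"
    then obtain m where "1 / ?p + 1 / ?q = of_int m" by (auto elim: Ints_cases)
    then have "rat_of_int (int q + int p) = rat_of_int (m * int q * int p)"
      using pq by (simp add: field_simps)
    then have "int q + int p = m * int q * int p" by (simp only: of_int_eq_iff)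
    then have "int p dvd int q" by (metis dvd_add_left_iff dvd_refl dvd_triv_right)
    then show False using prime_p prime_q p_neq_q primes_dvd_imp_eq by auto
  qed
  note frac = inverse_notin[OF prime_p] inverse_notin[OF prime_q] sum_notin
  have v0: "v 0 = ?q" by (simp add: v_def)
  \<comment> \<open>The solution of \<open>v w = v 0 + 1\<close>, hence the value of
    \<open>h c\<close> at 0.\<close>
  let ?w = "?p + ?p / ?q"
  have "?w / ?p = 1 + 1 / ?q" using pq by (simp add: field_simps)
  moreover have "1 + 1 / ?q \<notin> \<int>" using frac(2) by (metis Ints_1 Ints_diff add_diff_cancel_left')
  ultimately have "v ?w = ?q * (1 + 1 / ?q)" by (simp only: v_def if_False add_0_right)
  also have "\<dots> = ?q + 1" using pq by (simp add: field_simps)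
  finally have "v ?w = ?q + 1" .
  moreover have "v (h c 0) = ?q + 1"
    using arg_cong[OF tc, of "\<lambda>g. h g 0"] c by (simp add: hm h(3) ha v0)
  ultimately have "h c 0 = ?w" using bij by (metis bij_pointE)
  then have eq: "v (?w + 1) = v 1 + 1"
    using arg_cong[OF tac, of "\<lambda>g. h g 0"] c by (simp add: hm h(3) ha)
  \<comment> \<open>Neither \<open>?w + 1\<close> nor 1 is an integer multiple of \<open>p\<close>,
    so \<open>v\<close> only scales them. The two sides of \<open>eq\<close> then differ by
    \<open>q\<close>.\<close>
  have "(?w + 1) / ?p = 1 + (1 / ?p + 1 / ?q)" using pq by (simp add: field_simps)
  moreover have "1 + (1 / ?p + 1 / ?q) \<notin> \<int>"
    using frac(3) by (metis Ints_1 Ints_diff add_diff_cancel_left')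
  ultimately have "v (?w + 1) = ?q * (1 + (1 / ?p + 1 / ?q))"
    by (simp only: v_def if_False add_0_right)
  moreover have "v 1 = ?q / ?p" using frac(1) by (simp add: v_def)
  ultimately have "?q * (1 + (1 / ?p + 1 / ?q)) = ?q / ?p + 1" using eq by simp
  then show False using pq by (simp add: field_simps)
qed

end

section \<open>Expansiveness and contraction groups\<close>

context baumslag_solitar
begin

section \<open>The base coset, its axis and expansiveness\<close>

lemma action_base:
  "g \<in> carrier \<Gamma> \<Longrightarrow> \<phi> g \<Lambda> = g <# \<Lambda>"
  using action_coset[of g \<one>] lcos_mult_one[OF subgroup.subset[OF subgroup_\<Lambda>]] by simp

lemma \<Lambda>_in: "\<Lambda> \<in> X"
  using coset_in[of \<one>] lcos_mult_one[OF subgroup.subset[OF subgroup_\<Lambda>]] by simp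

lemma fixes_base_iff:
  assumes "g \<in> carrier \<Gamma>"
  shows "\<phi> g \<Lambda> = \<Lambda> \<longleftrightarrow> g \<in> \<Lambda>"
proof
  assume "\<phi> g \<Lambda> = \<Lambda>"
  then have "\<one> <# \<Lambda> = g <# \<Lambda>"
    using assms lcos_mult_one[OF subgroup.subset[OF subgroup_\<Lambda>]] by (simp add: action_base)
  from coset_eqD[OF _ _ this] assms show "g \<in> \<Lambda>" by simp
next
  assume "g \<in> \<Lambda>"
  then show "\<phi> g \<Lambda> = \<Lambda>"
    using coset_eqI[of \<one> g] lcos_mult_one[OF subgroup.subset[OF subgroup_\<Lambda>]] assms
    by (simp add: action_base)
qed

text \<open>An element fixing the whole axis \<open>t\<^sup>n \<Lambda>\<close> agrees near the coset \<open>g \<Lambda>\<close> with some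
  \<open>a\<^sup>k\<close>, and \<open>k\<close> can be made divisible by any power of \<open>p q\<close>.\<close>

lemma fixes_axis_imp_one:
  assumes y: "y \<in> carrier G"
    and axis: "\<And>n. y (t [^] n <# \<Lambda>) = t [^] (n::nat) <# \<Lambda>"
      "\<And>n. y (inv (t [^] n) <# \<Lambda>) = inv (t [^] (n::nat)) <# \<Lambda>"
  shows "y = \<one>\<^bsub>G\<^esub>"
proof (rule ext[OF y G.one_closed])
  fix C assume C: "C \<in> X"
  then obtain g where g: "g \<in> carrier \<Gamma>" "C = g <# \<Lambda>" by (rule coset_obtain)
  obtain N where N: "\<And>k. (int p * int q) ^ N dvd k \<Longrightarrow> (a [^] (k::int) \<otimes> g) <# \<Lambda> = g <# \<Lambda>"
    using power_fixes_coset[OF g(1)] by blast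
  \<comment> \<open>Agreement at \<open>\<Lambda>\<close> makes the approximant a power of
    \<open>a\<close>, agreement at the two translates makes its exponent divisible by
    \<open>q^N\<close> and \<open>p^N\<close>, and \<open>C\<close> is where the conclusion is
    wanted.\<close>
  let ?F = "{\<Lambda>, t [^] N <# \<Lambda>, inv (t [^] N) <# \<Lambda>, C}"
  have F: "finite ?F" "?F \<subseteq> X" using C by (auto simp: \<Lambda>_in intro: coset_in)
  obtain \<gamma> where \<gamma>: "\<gamma> \<in> carrier \<Gamma>" "\<And>D. D \<in> ?F \<Longrightarrow> \<phi> \<gamma> D = y D"
    using approximation[OF y F] by blast
  have "y \<Lambda> = \<Lambda>"
    using axis(1)[of 0] lcos_mult_one[OF subgroup.subset[OF subgroup_\<Lambda>]] by simp
  then have "\<gamma> \<in> \<Lambda>" using \<gamma>(1) \<gamma>(2)[of \<Lambda>] by (simp add: fixes_base_iff)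
  then obtain k :: int where k: "\<gamma> = a [^] k" by (auto simp: in_\<Lambda>_iff)
  have "(a [^] k \<otimes> t [^] N) <# \<Lambda> = t [^] N <# \<Lambda>"
    using \<gamma>(2)[of "t [^] N <# \<Lambda>"] axis(1)[of N] by (simp add: k action_coset)
  then have "int q ^ N dvd k" by (rule q_pow_dvd_of_fixes)
  moreover have "(a [^] k \<otimes> inv (t [^] N)) <# \<Lambda> = inv (t [^] N) <# \<Lambda>"
    using \<gamma>(2)[of "inv (t [^] N) <# \<Lambda>"] axis(2)[of N] by (simp add: k action_coset)
  then have "int p ^ N dvd k" by (rule p_pow_dvd_of_fixes)
  ultimately have "(int p * int q) ^ N dvd k"
    using coprime_pq[of N N] by (simp add: power_mult_distrib divides_mult)
  from N[OF this] show "y C = \<one>\<^bsub>G\<^esub> C"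
    using \<gamma>(2)[of C] C g by (simp add: k one_apply action_coset)
qed

abbreviation \<alpha> where "\<alpha> \<equiv> conjugation G (\<phi> t)"

lemma expansive_\<alpha>: "expansive G \<tau> \<alpha>"
  unfolding expansive_def
proof (intro conjI exI)
  \<comment> \<open>The stabilizer of the base coset, written as agreement with the identity so that
    \<open>openin_agree\<close> applies.\<close>
  let ?K = "{f \<in> carrier G. \<forall>C\<in>{\<Lambda>}. f C = \<one>\<^bsub>G\<^esub> C}"
  show "topological_automorphism G \<tau> \<alpha>"
    by (rule topological_automorphism_conjugation[OF topological_group_G]) (simp add: action_closed)
  show "?K \<subseteq> carrier G" "\<one>\<^bsub>G\<^esub> \<in> ?K" "?K \<subseteq> ?K" by auto
  show "openin \<tau> ?K" by (rule openin_agree) (simp_all add: \<Lambda>_in)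
  have pow: "\<alpha> [^]\<^bsub>AutoGroup G\<^esub> n = conjugation G (\<phi> (t [^] n))" for n :: int
    by (simp add: G.conjugation_int_pow action_closed action.hom_int_pow)
  show "(\<Inter>n::int. (\<alpha> [^]\<^bsub>AutoGroup G\<^esub> n) ` ?K) = {\<one>\<^bsub>G\<^esub>}" (is "?I = _")
  proof
    show "?I \<subseteq> {\<one>\<^bsub>G\<^esub>}"
    proof
      fix y assume y: "y \<in> ?I"
      have yn: "y \<in> carrier G \<and> y (t [^] n <# \<Lambda>) = t [^] n <# \<Lambda>" for n :: int
      proof -
        from y obtain k where k: "k \<in> ?K" "y = conjugation G (\<phi> (t [^] n)) k"
          unfolding pow by blast
        then have kG: "k \<in> carrier G" and k\<Lambda>: "k \<Lambda> = \<Lambda>" by (simp_all add: one_apply \<Lambda>_in)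
        have "y \<in> carrier G"
          using k kG by (simp add: G.conjugation_closed action_closed)
        moreover have "y (t [^] n <# \<Lambda>) = t [^] n <# \<Lambda>"
          using k(2) kG k\<Lambda>
          by (simp add: conjugation_action_apply action_in action_inv \<Lambda>_in flip: action_base)
        ultimately show ?thesis by simp
      qed
      have "y = \<one>\<^bsub>G\<^esub>"
      proof (rule fixes_axis_imp_one)
        show "y (t [^] n <# \<Lambda>) = t [^] n <# \<Lambda>" for n :: nat
          using yn[of "int n"] by (simp add: int_pow_int)
        show "y (inv (t [^] n) <# \<Lambda>) = inv (t [^] n) <# \<Lambda>" for n :: nat
          using yn[of "- int n"] by (simp add: int_pow_neg_int)
      qed (use yn in blast)
      then show "y \<in> {\<one>\<^bsub>G\<^esub>}" by simp
    qed
    have "conjugation G (\<phi> (t [^] n)) \<one>\<^bsub>G\<^esub> = \<one>\<^bsub>G\<^esub>" for n :: int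
      by (simp add: G.conjugation_apply action_closed)
    then show "{\<one>\<^bsub>G\<^esub>} \<subseteq> ?I"
      unfolding pow by (auto intro!: image_eqI[of _ _ "\<one>\<^bsub>G\<^esub>"])
  qed
qed

text \<open>At a single coset, \<open>x\<close> acts as some \<open>a^(k i)\<close> with
  \<open>i \<ge> n + N\<close>. Moving \<open>s^n\<close> past it trades \<open>P^n\<close> for
  \<open>Q^n\<close> and leaves an exponent divisible by \<open>Q^n P^N\<close>, hence by
  \<open>(p q)^N\<close> once \<open>n \<ge> N\<close>. The parameters cover both
  \<open>(t, p, q)\<close> and \<open>(inv t, q, p)\<close>.\<close>

lemma limit_in_contraction_group:
  fixes P Q :: nat and k :: "nat \<Rightarrow> int"
  assumes s: "s \<in> carrier \<Gamma>" and PQ: "P * Q = p * q"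
    and s_pow: "\<And>n m. s [^] n \<otimes> a [^] (int P ^ n * m) = a [^] (int Q ^ n * m) \<otimes> s [^] n"
    and x: "x \<in> carrier G"
    and lim: "\<And>C. C \<in> X \<Longrightarrow> \<forall>\<^sub>F i in sequentially. \<phi> (a [^] k i) C = x C"
    and dvd: "\<And>i. int P ^ i dvd k i"
  shows "x \<in> contraction_group G \<tau> (conjugation G (\<phi> s))"
  unfolding contraction_group_iff[OF s]
proof (intro conjI ballI)
  fix C assume "C \<in> X"
  then obtain g where g: "g \<in> carrier \<Gamma>" "C = g <# \<Lambda>" by (rule coset_obtain)
  obtain N where N: "\<And>k. (int p * int q) ^ N dvd k \<Longrightarrow> (a [^] (k::int) \<otimes> g) <# \<Lambda> = g <# \<Lambda>"
    using power_fixes_coset[OF g(1)] by blast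
  have P0: "P \<noteq> 0" using PQ p_pos q_pos by (metis mult_is_0 not_gr_zero)
  show "\<forall>\<^sub>F n in sequentially. \<phi> (s [^] n) (x (\<phi> (inv (s [^] n)) C)) = C"
    unfolding eventually_sequentially
  proof (intro exI allI impI)
    fix n :: nat assume n: "N \<le> n"
    let ?D = "\<phi> (inv (s [^] n)) C"
    have D: "?D \<in> X" using s g by (simp add: action_in coset_in)
    \<comment> \<open>The index \<open>i\<close> may depend on \<open>n\<close>, since
      \<open>x\<close> has to be matched only at \<open>?D\<close>.\<close>
    obtain i where i: "n + N \<le> i" "\<phi> (a [^] k i) ?D = x ?D"
      using lim[OF D] unfolding eventually_sequentially by (metis le_add1 le_add2)
    have "int P ^ (n + N) dvd k i" using dvd[of i] i(1) by (rule power_le_dvd)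
    then obtain m where m: "k i = int P ^ n * (int P ^ N * m)"
      by (auto simp: power_add dvd_def mult.assoc)
    have "\<phi> (s [^] n) (x ?D) = \<phi> (s [^] n \<otimes> a [^] k i) ?D"
      using s D by (simp add: action_mult flip: i(2))
    also have "\<dots> = \<phi> (a [^] (int Q ^ n * (int P ^ N * m))) (\<phi> (s [^] n) ?D)"
      unfolding m s_pow using s D by (simp add: action_mult)
    also have "\<phi> (s [^] n) ?D = C" using s g by (simp add: action_inv coset_in)
    also have "\<phi> (a [^] (int Q ^ n * (int P ^ N * m))) C = C"
    proof -
      have "(int p * int q) ^ N = int Q ^ N * int P ^ N"
        using PQ by (metis mult.commute of_nat_mult power_mult_distrib)
      moreover have "int Q ^ N dvd int Q ^ n" using n by (rule le_imp_power_dvd)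
      ultimately have "(int p * int q) ^ N dvd int Q ^ n * (int P ^ N * m)"
        by (simp add: mult_dvd_mono)
      from N[OF this] show ?thesis using g by (simp add: action_coset)
    qed
    finally show "\<phi> (s [^] n) (x ?D) = C" .
  qed
qed (rule x)

text \<open>The closure of \<open>\<langle>a\<rangle>\<close> is \<open>\<int>\<^sub>p \<times> \<int>\<^sub>q\<close>; the two factors are contracted by \<open>\<alpha>\<^sup>-\<^sup>1\<close> and
  by \<open>\<alpha>\<close>. The exponents \<open>k i\<close> below converge to \<open>(0, 1)\<close>.\<close>

lemma a_factorization:
  obtains x y where "x \<in> contraction_group G \<tau> \<alpha>"
    "y \<in> contraction_group G \<tau> (conjugation G (\<phi> (inv t)))" "\<phi> a = x \<otimes>\<^bsub>G\<^esub> y"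
proof -
  have "\<exists>k. int p ^ i dvd k \<and> int q ^ i dvd 1 - k" for i
  proof -
    \<comment> \<open>By Bezout, \<open>u p^i\<close> is 0 modulo \<open>p^i\<close> and 1 modulo
      \<open>q^i\<close>.\<close>
    obtain u v where "u * int p ^ i + v * int q ^ i = 1"
      using bezout_int[of "int p ^ i" "int q ^ i"] coprime_pq[of i i] by auto
    then have "1 - u * int p ^ i = v * int q ^ i" by simp
    then show ?thesis by (intro exI[of _ "u * int p ^ i"]) simp
  qed
  then obtain k where k: "\<And>i. int p ^ i dvd k i" "\<And>i. int q ^ i dvd 1 - k i" by metis
  have cauchy: "(int p * int q) ^ N dvd k n - k N" if "N \<le> n" for n N
  proof -
    have "int p ^ N dvd k n - k N"
      using k(1)[of N] power_le_dvd[OF k(1)[of n] that] by simp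
    moreover have "int q ^ N dvd (1 - k N) - (1 - k n)"
      using k(2)[of N] power_le_dvd[OF k(2)[of n] that] by (rule dvd_diff)
    then have "int q ^ N dvd k n - k N" by simp
    ultimately show ?thesis
      using coprime_pq[of N N] by (simp add: power_mult_distrib divides_mult)
  qed
  \<comment> \<open>The factor \<open>e\<close> will be 1 and -1, because
    \<open>limit_exists\<close> needs both the powers and their inverses to stabilize.\<close>
  have const: "\<exists>D. \<forall>\<^sub>F n in sequentially. \<phi> (a [^] (e * k n)) C = D" if C: "C \<in> X" for C and e :: int
  proof -
    obtain g where g: "g \<in> carrier \<Gamma>" "C = g <# \<Lambda>" using C by (rule coset_obtain)
    obtain N where N: "\<And>k. (int p * int q) ^ N dvd k \<Longrightarrow> (a [^] (k::int) \<otimes> g) <# \<Lambda> = g <# \<Lambda>"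
      using power_fixes_coset[OF g(1)] by blast
    have "\<phi> (a [^] (e * k n)) C = \<phi> (a [^] (e * k N)) C" if "N \<le> n" for n
    proof -
      have "\<phi> (a [^] (e * k n)) C = \<phi> (a [^] (e * k N)) (\<phi> (a [^] (e * (k n - k N))) C)"
        using C by (simp add: action_mult[symmetric] int_pow_mult[symmetric] algebra_simps)
      also have "\<phi> (a [^] (e * (k n - k N))) C = C"
        using N[of "e * (k n - k N)"] cauchy[OF that] g by (simp add: action_coset)
      finally show ?thesis .
    qed
    then show ?thesis unfolding eventually_sequentially by blast
  qed
  obtain x where x: "x \<in> carrier G"
    "\<And>C. C \<in> X \<Longrightarrow> \<forall>\<^sub>F n in sequentially. \<phi> (a [^] k n) C = x C"
  proof (rule limit_exists[of "\<lambda>n. a [^] k n"])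
    fix C assume "C \<in> X"
    then show "\<exists>D. \<forall>\<^sub>F n in sequentially. \<phi> (a [^] k n) C = D"
      "\<exists>D. \<forall>\<^sub>F n in sequentially. \<phi> (inv (a [^] k n)) C = D"
      using const[of C 1] const[of C "-1"] by (simp_all add: int_pow_neg)
  qed simp_all
  \<comment> \<open>The complementary factor is the limit of \<open>a^(1 - k i)\<close>, whose
    exponents are divisible by \<open>q^i\<close>.\<close>
  define y where "y = inv\<^bsub>G\<^esub> x \<otimes>\<^bsub>G\<^esub> \<phi> a"
  have y: "y \<in> carrier G" using x by (simp add: y_def action_closed)
  have "\<phi> a = x \<otimes>\<^bsub>G\<^esub> y"
    using x by (simp add: y_def action_closed G.m_assoc[symmetric])
  moreover have "x \<in> contraction_group G \<tau> \<alpha>"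
    by (rule limit_in_contraction_group[OF t_closed HOL.refl t_pow_a_pow x k(1)])
  moreover have "y \<in> contraction_group G \<tau> (conjugation G (\<phi> (inv t)))"
  proof (rule limit_in_contraction_group[OF inv_closed[OF t_closed] mult.commute inv_t_pow_a_pow y _ k(2)])
    fix C assume C: "C \<in> X"
    \<comment> \<open>Chosen so that \<open>x\<close> maps \<open>?D\<close> to
      \<open>\<phi> a C\<close>. Stabilization of the powers at \<open>?D\<close> then determines
      the inverse of \<open>x\<close> at \<open>\<phi> a C\<close>.\<close>
    let ?D = "(inv\<^bsub>G\<^esub> x) (\<phi> a C)"
    have aC: "\<phi> a C \<in> X" using C by (simp add: action_in)
    have D: "?D \<in> X" by (rule image_in[OF G.inv_closed[OF x(1)] aC])
    show "\<forall>\<^sub>F i in sequentially. \<phi> (a [^] (1 - k i)) C = y C"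
      using x(2)[OF D]
    proof eventually_elim
      case (elim i)
      then have "\<phi> (a [^] k i) ?D = \<phi> a C" using inv_apply_eq(2)[OF x(1) aC] by simp
      then have "?D = \<phi> (inv (a [^] k i)) (\<phi> a C)" using action_inv(2)[of "a [^] k i" ?D] D by simp
      also have "\<dots> = \<phi> (a [^] (1 - k i)) C"
        using C int_pow_mult[of a "- k i" 1] by (simp add: action_mult[symmetric] int_pow_neg)
      finally show ?case using x C by (simp add: y_def mult_apply action_closed)
    qed
  qed
  ultimately show thesis using that by blast
qed

text \<open>For one large \<open>n\<close>, \<open>x\<close> fixes \<open>t^(-n) \<Lambda>\<close>
  and \<open>y\<close> fixes \<open>t^n \<Lambda>\<close>. Replacing \<open>x\<close> on these two
  cosets by an element of \<open>\<Gamma>\<close> turns the factorization into a word identity,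
  which the affine action can evaluate.\<close>

lemma affine_trivial_in_product_imp_one:
  assumes h: "group_hom \<Gamma> (BijGroup (UNIV :: rat set)) h"
    "\<And>k::int. h (a [^] k) = (\<lambda>x. x + of_int k)"
    "\<And>n. h (t [^] n) = (\<lambda>x. (of_nat q / of_nat p) ^ n * x)"
    and g: "g \<in> carrier \<Gamma>" "\<And>z. h g z = z"
    and x: "x \<in> contraction_group G \<tau> \<alpha>"
    and y: "y \<in> contraction_group G \<tau> (conjugation G (\<phi> (inv t)))"
    and prod: "\<phi> g = x \<otimes>\<^bsub>G\<^esub> y"
  shows "g = \<one>"
proof -
  have xG: "x \<in> carrier G" and yG: "y \<in> carrier G"
    using x y by (simp_all add: contraction_group_def)
  have "\<forall>\<^sub>F n in sequentially. \<phi> (t [^] n) (x (\<phi> (inv (t [^] n)) \<Lambda>)) = \<Lambda>"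
    using x contraction_group_iff[OF t_closed] \<Lambda>_in by blast
  moreover have "\<forall>\<^sub>F n in sequentially. \<phi> (inv t [^] n) (y (\<phi> (inv (inv t [^] n)) \<Lambda>)) = \<Lambda>"
    using y contraction_group_iff[OF inv_closed[OF t_closed]] \<Lambda>_in by blast
  ultimately have "\<forall>\<^sub>F n in sequentially. \<phi> (t [^] n) (x (\<phi> (inv (t [^] n)) \<Lambda>)) = \<Lambda> \<and>
      \<phi> (inv t [^] n) (y (\<phi> (inv (inv t [^] n)) \<Lambda>)) = \<Lambda>"
    by (rule eventually_conj)
  then obtain n :: nat where n: "\<phi> (t [^] n) (x (\<phi> (inv (t [^] n)) \<Lambda>)) = \<Lambda>"
      "\<phi> (inv t [^] n) (y (\<phi> (inv (inv t [^] n)) \<Lambda>)) = \<Lambda>"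
    using eventually_happens'[OF sequentially_bot] by blast
  define s where "s = t [^] n"
  have s: "s \<in> carrier \<Gamma>" by (simp add: s_def)
  have inv_s: "inv t [^] n = inv s" by (simp add: s_def nat_pow_inv)
  have sX: "\<phi> s \<Lambda> \<in> X" "\<phi> (inv s) \<Lambda> \<in> X" using s by (simp_all add: action_in \<Lambda>_in)
  have x_fix: "x (\<phi> (inv s) \<Lambda>) = \<phi> (inv s) \<Lambda>"
    using action_inv(2)[OF s image_in[OF xG sX(2)]] n(1) by (simp add: s_def)
  have y_fix: "y (\<phi> s \<Lambda>) = \<phi> s \<Lambda>"
    using action_inv(1)[OF s image_in[OF yG sX(1)]] n(2) s by (simp add: inv_s)
  have "finite {\<phi> (inv s) \<Lambda>, \<phi> s \<Lambda>}" "{\<phi> (inv s) \<Lambda>, \<phi> s \<Lambda>} \<subseteq> X"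
    using sX by simp_all
  then obtain \<gamma> where \<gamma>_in: "\<gamma> \<in> carrier \<Gamma>"
    and \<gamma>_eq: "\<And>C. C \<in> {\<phi> (inv s) \<Lambda>, \<phi> s \<Lambda>} \<Longrightarrow> \<phi> \<gamma> C = x C"
    using approximation[OF xG] by metis
  note \<gamma> = \<gamma>_in \<gamma>_eq[OF insertI1] \<gamma>_eq[OF insertI2[OF singletonI]]
  \<comment> \<open>Since \<open>\<gamma>\<close> acts as \<open>x\<close> on
    \<open>inv s <# \<Lambda>\<close>, it fixes this coset, so its conjugate by \<open>s\<close> is
    a power of \<open>a\<close>.\<close>
  have "\<phi> (s \<otimes> \<gamma> \<otimes> inv s) \<Lambda> = \<Lambda>"
    using s \<gamma> x_fix by (simp add: action_mult action_in \<Lambda>_in action_inv)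
  then have "s \<otimes> \<gamma> \<otimes> inv s \<in> \<Lambda>" using s \<gamma> by (simp add: fixes_base_iff)
  then obtain i :: int where "s \<otimes> \<gamma> \<otimes> inv s = a [^] i" by (auto simp: in_\<Lambda>_iff)
  then have i: "s \<otimes> \<gamma> = a [^] i \<otimes> s" using s \<gamma> by (simp add: inv_solve_right')
  \<comment> \<open>Here \<open>y\<close> drops out because it fixes the coset of \<open>s\<close>.
    So \<open>g \<otimes> s\<close> and \<open>\<gamma> \<otimes> s\<close> differ by a power of
    \<open>a\<close> on the right.\<close>
  have "\<phi> g (\<phi> s \<Lambda>) = \<phi> \<gamma> (\<phi> s \<Lambda>)"
    using \<gamma>(3) y_fix xG yG sX by (simp add: prod mult_apply)
  then have "(\<gamma> \<otimes> s) <# \<Lambda> = (g \<otimes> s) <# \<Lambda>"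
    using s \<gamma>(1) g(1) by (simp add: action_coset action_base)
  then have "inv (\<gamma> \<otimes> s) \<otimes> (g \<otimes> s) \<in> \<Lambda>"
    using s \<gamma>(1) g(1) by (intro coset_eqD) auto
  then obtain j :: int where "inv (\<gamma> \<otimes> s) \<otimes> (g \<otimes> s) = a [^] j" by (auto simp: in_\<Lambda>_iff)
  then have j: "g \<otimes> s = \<gamma> \<otimes> s \<otimes> a [^] j"
    using s \<gamma>(1) g(1) by (simp add: inv_solve_left')
  have "s \<otimes> (g \<otimes> s) = (s \<otimes> \<gamma>) \<otimes> (s \<otimes> a [^] j)"
    using s \<gamma>(1) g(1) by (simp add: j m_assoc)
  also have "\<dots> = a [^] i \<otimes> t [^] (n + n) \<otimes> a [^] j"
    using s by (simp add: i m_assoc) (simp add: s_def nat_pow_mult[symmetric] m_assoc)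
  finally have eq: "s \<otimes> (g \<otimes> s) = a [^] i \<otimes> t [^] (n + n) \<otimes> a [^] j" .
  note hm = group_hom_BijGroup_UNIV(1)[OF h(1)]
  from arg_cong[OF eq, of "\<lambda>g. h g 0"]
  \<comment> \<open>The left side vanishes because \<open>g\<close> acts trivially and scaling fixes
    0.\<close>
  have "0 = of_int i + (of_nat q / of_nat p) ^ (n + n) * rat_of_int j"
    using s g by (simp add: hm h(2)) (simp add: s_def h(3))
  then have "rat_of_int (int p ^ (n + n) * i) = rat_of_int (- (int q ^ (n + n) * j))"
    using p_pos by (simp add: field_simps)
  then have ij: "int p ^ (n + n) * i = - (int q ^ (n + n) * j)" by (simp only: of_int_eq_iff)
  then have "int q ^ (n + n) dvd int p ^ (n + n) * i" by simp
  then have "int q ^ (n + n) dvd i"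
    using coprime_pq[of "n + n" "n + n"] by (simp add: coprime_dvd_mult_right_iff coprime_commute)
  then obtain r where r: "i = int q ^ (n + n) * r" ..
  with ij have "int q ^ (n + n) * j = int q ^ (n + n) * (- (int p ^ (n + n) * r))"
    by (simp add: mult.left_commute)
  moreover have "int q ^ (n + n) \<noteq> 0" using q_pos by simp
  ultimately have j': "j = - (int p ^ (n + n) * r)" by (metis mult_left_cancel)
  \<comment> \<open>Moving \<open>a^i\<close> to the right through \<open>t^(2n)\<close> turns its
    exponent into \<open>p^(2n) r\<close>, which cancels \<open>j\<close>.\<close>
  have "s \<otimes> (g \<otimes> s) = t [^] (n + n) \<otimes> (a [^] (int p ^ (n + n) * r) \<otimes> a [^] j)"
    unfolding eq r t_pow_a_pow[symmetric] by (simp add: m_assoc)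
  also have "\<dots> = s \<otimes> s"
    unfolding j' by (simp add: int_pow_neg s_def nat_pow_mult)
  finally show ?thesis using s g by simp
qed

text \<open>Both factors are stable under \<open>\<alpha>\<close>, so the product set contains
  \<open>t a t^(-1)\<close> along with \<open>a\<close>. As a subgroup it would contain their
  commutator \<open>g\<close>. Both elements act affinely as translations, so \<open>g\<close> acts
  trivially and must be 1, but the two do not commute.\<close>

lemma not_subgroup_product:
  "\<not> subgroup (contraction_group G \<tau> \<alpha> <#>\<^bsub>G\<^esub>
      contraction_group G \<tau> (conjugation G (\<phi> (inv t)))) G"
    (is "\<not> subgroup ?H G")
proof
  assume H: "subgroup ?H G"
  let ?c = "t \<otimes> a \<otimes> inv t"
  obtain x y where xy: "x \<in> contraction_group G \<tau> \<alpha>"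
    "y \<in> contraction_group G \<tau> (conjugation G (\<phi> (inv t)))" "\<phi> a = x \<otimes>\<^bsub>G\<^esub> y"
    by (rule a_factorization)
  have xyG: "x \<in> carrier G" "y \<in> carrier G" using xy by (simp_all add: contraction_group_def)
  have a_in: "\<phi> a \<in> ?H" using xy by (auto simp: set_mult_def)
  have "\<phi> ?c = \<alpha> (\<phi> a)"
    by (simp add: G.conjugation_apply action_closed action.hom_inv action.hom_mult)
  also have "\<dots> = \<alpha> x \<otimes>\<^bsub>G\<^esub> \<alpha> y"
    using xyG G.conjugation_in_auto[of "\<phi> t"]
    by (simp add: xy(3) auto_def hom_mult action_closed)
  finally have "\<phi> ?c = \<alpha> x \<otimes>\<^bsub>G\<^esub> \<alpha> y" .
  moreover have "\<alpha> x \<in> contraction_group G \<tau> \<alpha>"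
    by (rule contraction_group_conjugate) (simp_all add: xy)
  moreover have "\<alpha> y \<in> contraction_group G \<tau> (conjugation G (\<phi> (inv t)))"
    by (rule contraction_group_conjugate) (simp_all add: xy)
  ultimately have c_in: "\<phi> ?c \<in> ?H" by (auto simp: set_mult_def)
  define g where "g = ?c \<otimes> a \<otimes> inv ?c \<otimes> inv a"
  have g: "g \<in> carrier \<Gamma>" by (simp add: g_def)
  have comm: "g \<otimes> (a \<otimes> ?c) = ?c \<otimes> a"
  proof -
    define c where "c = ?c"
    have c: "c \<in> carrier \<Gamma>" by (simp add: c_def)
    have "c \<otimes> a \<otimes> inv c \<otimes> inv a \<otimes> (a \<otimes> c) = c \<otimes> a \<otimes> (inv c \<otimes> (inv a \<otimes> (a \<otimes> c)))"
      using c by (simp add: m_assoc)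
    also have "\<dots> = c \<otimes> a" using c by (simp add: m_assoc[symmetric])
    finally show ?thesis unfolding g_def c_def .
  qed
  have "\<phi> g \<in> ?H"
  proof -
    have "\<phi> g = \<phi> ?c \<otimes>\<^bsub>G\<^esub> \<phi> a \<otimes>\<^bsub>G\<^esub> inv\<^bsub>G\<^esub> \<phi> ?c \<otimes>\<^bsub>G\<^esub> inv\<^bsub>G\<^esub> \<phi> a"
      unfolding g_def by (simp only: action.hom_mult action.hom_inv m_closed inv_closed a_closed t_closed)
    then show ?thesis
      using a_in c_in by (simp only: subgroup.m_closed[OF H] subgroup.m_inv_closed[OF H])
  qed
  then obtain x' y' where xy': "x' \<in> contraction_group G \<tau> \<alpha>"
    "y' \<in> contraction_group G \<tau> (conjugation G (\<phi> (inv t)))" "\<phi> g = x' \<otimes>\<^bsub>G\<^esub> y'"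
    by (auto simp: set_mult_def)
  obtain h where h: "group_hom \<Gamma> (BijGroup (UNIV :: rat set)) h"
    "\<And>k::int. h (a [^] k) = (\<lambda>x. x + of_int k)"
    "\<And>n. h (t [^] n) = (\<lambda>x. (of_nat q / of_nat p) ^ n * x)"
    using affine_action by blast
  note hm = group_hom_BijGroup_UNIV(1)[OF h(1)]
  have ha: "h a = (\<lambda>x. x + 1)" using h(2)[of 1] by simp
  have ht: "h t = (\<lambda>x. of_nat q / of_nat p * x)" using h(3)[of 1] by simp
  \<comment> \<open>This gives \<open>h ?c\<close> at the points \<open>(q / p) z\<close>, which are
    all rationals, without computing the action of \<open>inv t\<close>.\<close>
  have "?c \<otimes> t = t \<otimes> a" by (simp add: m_assoc)
  then have "h (?c \<otimes> t) z = h (t \<otimes> a) z" for z by simp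
  then have "h ?c (h t z) = h t (h a z)" for z
    by (simp only: hm a_closed t_closed m_closed inv_closed)
  then have hc': "h ?c (of_nat q / of_nat p * z) = of_nat q / of_nat p * (z + 1)" for z
    by (simp only: ha ht)
  have hc: "h ?c z = z + of_nat q / of_nat p" for z
    using hc'[of "of_nat p / of_nat q * z"] p_pos q_pos by (simp add: distrib_left)
  have hg: "h g z = z" for z
  proof -
    \<comment> \<open>The argument is the point that \<open>a \<otimes> ?c\<close> sends to
      \<open>z\<close>.\<close>
    have "h g (h a (h ?c (z - 1 - of_nat q / of_nat p))) = h ?c (h a (z - 1 - of_nat q / of_nat p))"
      using arg_cong[OF comm, of "\<lambda>g. h g (z - 1 - of_nat q / of_nat p)"] g
      by (simp only: hm a_closed t_closed m_closed inv_closed)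
    then show ?thesis by (simp add: hc ha)
  qed
  have "g = \<one>" by (rule affine_trivial_in_product_imp_one[OF h g hg xy'])
  with comm have "a \<otimes> ?c = ?c \<otimes> a" by simp
  then show False using t_a_inv_t_not_commutes_a by simp
qed

end

section \<open>From the locale to the general definitions\<close>

theorem theoremE:
  fixes p q :: nat
  assumes "prime p" and "prime q" and "p \<noteq> q"
  defines "\<Gamma> \<equiv> BS p q"
  defines "\<Lambda> \<equiv> generate \<Gamma> {bs_a p q}"
  defines "G \<equiv> schlichting \<Gamma> \<Lambda>"
  defines "\<tau> \<equiv> schlichting_topology \<Gamma> \<Lambda>"
  defines "\<alpha> \<equiv> conjugation G (coset_action \<Gamma> \<Lambda> (bs_t p q))"
  shows "expansive G \<tau> \<alpha> \<and>
    \<not> subgroup (contraction_group G \<tau> \<alpha> <#>\<^bsub>G\<^esub>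
                 contraction_group G \<tau> (inv\<^bsub>AutoGroup G\<^esub> \<alpha>)) G"
proof -
  interpret bs: baumslag_solitar \<Gamma> p q
    using assms(1-3) group_BS[of p q]
    by (simp add: baumslag_solitar_def baumslag_solitar_axioms_def \<Gamma>_def)
  have G: "G = bs.G" and \<tau>: "\<tau> = bs.\<tau>"
    unfolding G_def \<tau>_def \<Lambda>_def by (rule bs.schlichting_eq)+
  have \<alpha>: "\<alpha> = bs.\<alpha>" by (simp only: \<alpha>_def G \<Lambda>_def)
  \<comment> \<open>The second contraction group is defined through the inverse in
    \<open>AutoGroup G\<close>, while the locale results use conjugation by the image of
    \<open>inv t\<close>.\<close>
  have "inv\<^bsub>AutoGroup G\<^esub> \<alpha> = conjugation bs.G (bs.\<phi> (inv\<^bsub>\<Gamma>\<^esub> bs.t))"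
    by (simp only: G \<alpha> bs.G.inv_conjugation bs.action_closed bs.action.hom_inv bs.t_closed)
  then show ?thesis
    using bs.expansive_\<alpha> bs.not_subgroup_product by (simp only: G \<tau> \<alpha> simp_thms)
qed

end
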